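(* Let $\mathbb{P}=\{\pm p : p \text{ a prime number}\}\subseteq\mathbb{R}$. With respect to the van Hove sequence $(A_n)_n=([-n,n])_n$, the counting autocorrelation of $\mathbb{P}$ exists and $\gamma_{\mathrm{count}}=\delta_0$, and the counting diffraction is $\widehat{\gamma_{\mathrm{count}}}=\lambda$, the Lebesgue measure on $\mathbb{R}$.
   Context: For a finite set $F\subseteq\mathbb{R}$ put $\gamma_F=\frac{1}{\mathrm{card}(F)}\sum_{x,y\in F}\delta_{x-y}$ if $F\neq\emptyset$ and $\gamma_\emptyset=0$. For a locally finite $\varLambda\subseteq\mathbb{R}$ and compact sets $A_n$, let $F_n=\varLambda\cap A_n$. The counting autocorrelation of $\varLambda$ with respect to $(A_n)_n$ is the vague limit $\gamma_{\mathrm{count}}=\lim_n\gamma_{F_n}$ (if it exists), i.e. $\gamma_{F_n}(f)\to\gamma_{\mathrm{count}}(f)$ for all compactly supported continuous $f$; its Fourier transform $\widehat{\gamma_{\mathrm{count}}}$ (a positive measure) is the counting diffraction. *)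

theory Defs
  imports "HOL-Analysis.Analysis" "HOL-Computational_Algebra.Primes"
begin

definition signed_primes :: "real set" where
  "signed_primes = {x. \<exists>p::nat. prime p \<and> (x = real p \<or> x = - real p)}"

definition dirac0 :: "real measure" where
  "dirac0 = measure_of UNIV (sets borel) (\<lambda>A. indicator A (0::real))"

definition Cc :: "(real \<Rightarrow> complex) set" where
  "Cc = {f. continuous_on UNIV f \<and> (\<exists>K. compact K \<and> (\<forall>x. x \<notin> K \<longrightarrow> f x = 0))}"

definition gammaF :: "real set \<Rightarrow> (real \<Rightarrow> complex) \<Rightarrow> complex" where
  "gammaF F f = (if F = {} then 0
     else (1 / of_nat (card F)) * (\<Sum>x\<in>F. \<Sum>y\<in>F. f (x - y)))"

definition has_counting_autocorrelation ::
    "real set \<Rightarrow> (nat \<Rightarrow> real set) \<Rightarrow> real measure \<Rightarrow> bool" where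
  "has_counting_autocorrelation \<Lambda> A \<gamma> \<longleftrightarrow>
     (\<forall>f\<in>Cc. (\<lambda>n. gammaF (\<Lambda> \<inter> A n) f) \<longlonglongrightarrow> integral\<^sup>L \<gamma> f)"

definition conv :: "(real \<Rightarrow> complex) \<Rightarrow> (real \<Rightarrow> complex) \<Rightarrow> real \<Rightarrow> complex" where
  "conv g h x = integral\<^sup>L lborel (\<lambda>t. g t * h (x - t))"

definition icheck :: "(real \<Rightarrow> complex) \<Rightarrow> real \<Rightarrow> complex" where
  "icheck f x = integral\<^sup>L lborel (\<lambda>t. f t * cis (2 * pi * x * t))"

text \<open>mu (a positive measure on the Borel sets) is the Fourier transform of gamma:
  for every f in K_2(R) = span of convolutions g * h with g, h in C_c,
  check f is mu-integrable and gamma(f) = mu(check f).\<close>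
definition fourier_transform_of :: "real measure \<Rightarrow> real measure \<Rightarrow> bool" where
  "fourier_transform_of \<gamma> \<mu> \<longleftrightarrow> sets \<mu> = sets borel \<and>
     (\<forall>g\<in>Cc. \<forall>h\<in>Cc.
        integrable \<mu> (icheck (conv g h)) \<and>
        integral\<^sup>L \<gamma> (conv g h) = integral\<^sup>L \<mu> (icheck (conv g h)))"

end

(* For a test function f supported in [-R, R], gamma_F(f) differs from f(0) by at most
   (sup |f| / card F) times the number of pairs of distinct points of F at distance at most R.
   For F = signed primes up to n these are, up to O(R^2) many, pairs p, p + k of primes with
   1 <= k <= R. Brun's pure sieve bounds their number by O(n / (log n)^(4/3)), and
   card F >> n / log n by Chebyshev, so only the diagonal survives.

   For the diffraction, weighting the transform of g * h with wide Gaussians turns its integral into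
   an average of g * h against narrow normal densities, which tends to (g * h)(0). Applied to
   h = cnj g(-t) this gives square integrability by monotone convergence, hence
   integrability of the product of the transforms of g and h in general; dominated convergence
   then removes the weight. *)
theory Submission
  imports Defs "HOL-Number_Theory.Cong" "HOL-Real_Asymp.Real_Asymp"
    "HOL-Probability.Characteristic_Functions"
begin

subsection \<open>Brun's pure sieve for pairs of primes\<close>

text \<open>The count of close prime pairs has to be o(n / ln n), so a saving of any power of ln n
  with exponent above 1 is enough. Sieving by the primes up to N leaves a density of order 1 / (ln
  N)^2. Truncating inclusion-exclusion at sets of size r leaves rounding errors of about N^r, and r
  must exceed a multiple of the sum S of 1/p over the sieving primes. Only the cheap bound S =
  O(sqrt (ln N)) is proved. With ln N about s^2 this makes r of order s and the error exp (O(s^3)),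
  hence s of order (ln n)^(1/3) and a saving s^4 of order (ln n)^(4/3).

  On the Fourier side the obstacle is that the transform of a function in \<open>Cc\<close> need not
  be integrable, so inversion cannot start from unweighted integrals. The Gaussian weight makes
  every integral converge before any integrability is known.\<close>

lemma card_cong_eq:
  fixes q a n :: nat
  assumes "1 \<le> a" "a \<le> q"
  shows "card {m\<in>{1..n}. [m = a] (mod q)} = (n + q - a) div q"
proof (induction n)
  case 0
  show ?case using assms by (simp add: div_if)
next
  case (Suc n)
  have eq: "{m\<in>{1..Suc n}. [m = a] (mod q)}
      = {m\<in>{1..n}. [m = a] (mod q)} \<union> (if [Suc n = a] (mod q) then {Suc n} else {})"
    by (auto simp: le_Suc_eq)
  \<comment> \<open>The quotient grows by one exactly when \<open>q\<close> divides
    \<open>Suc (n + q - a)\<close>. Adding \<open>q - a\<close> to both sides identifies this with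
    \<open>Suc n\<close> entering the class.\<close>
  have "[Suc n = a] (mod q) \<longleftrightarrow> [Suc n + (q - a) = a + (q - a)] (mod q)"
    by (simp only: cong_add_rcancel_nat)
  also have "\<dots> \<longleftrightarrow> Suc (n + q - a) mod q = 0"
    using assms by (simp add: cong_def)
  finally have iff: "[Suc n = a] (mod q) \<longleftrightarrow> Suc (n + q - a) mod q = 0" .
  have "Suc n + q - a = Suc (n + q - a)" using assms by simp
  then show ?case
    unfolding eq using Suc.IH by (subst card_Un_disjoint) (auto simp: div_Suc iff)
qed

lemma card_cong_bound:
  fixes q a n :: nat
  assumes "q > 0"
  shows "\<bar>real (card {m\<in>{1..n}. [m = a] (mod q)}) - n / q\<bar> \<le> 1"
proof -
  \<comment> \<open>The residue is taken in 1..q rather than 0..q-1 because the counted interval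
    starts at 1.\<close>
  define b where "b = (if a mod q = 0 then q else a mod q)"
  have b: "1 \<le> b" "b \<le> q" "[a = b] (mod q)"
    using assms by (auto simp: b_def cong_def intro: less_imp_le)
  have "{m\<in>{1..n}. [m = a] (mod q)} = {m\<in>{1..n}. [m = b] (mod q)}"
    using b(3) by (meson cong_sym cong_trans)
  then have c: "card {m\<in>{1..n}. [m = a] (mod q)} = (n + q - b) div q"
    using card_cong_eq[OF b(1,2)] by simp
  define d where "d = (n + q - b) div q"
  have "n + q - b < q * d + q" "q * d \<le> n + q - b"
    using assms unfolding d_def
    by (metis dividend_less_times_div add.commute, simp add: mult.commute div_times_less_eq_dividend)
  then have "n < q * d + q" "q * d \<le> n + q" using b by linarith+
  then have "real n < real q * d + q" "real q * d \<le> n + q"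
    by (metis of_nat_less_iff of_nat_mult of_nat_add, metis of_nat_le_iff of_nat_mult of_nat_add)
  then show ?thesis
    unfolding c d_def[symmetric] using assms by (simp add: abs_le_iff field_simps)
qed

lemma prime_dvd_shift_iff:
  fixes p k m :: nat
  assumes "prime p" "0 < k" "k < p"
  shows "p dvd m * (m + k) \<longleftrightarrow> [m = 0] (mod p) \<or> [m = p - k] (mod p)"
proof -
  have "p dvd m + k \<longleftrightarrow> [m + k = (p - k) + k] (mod p)"
    using assms by (simp add: cong_def dvd_eq_mod_eq_0)
  also have "\<dots> \<longleftrightarrow> [m = p - k] (mod p)"
    by (simp only: cong_add_rcancel_nat)
  finally show ?thesis
    using assms(1) by (simp add: prime_dvd_mult_iff cong_0_iff)
qed

text \<open>
  Induction on \<open>D\<close> works because by the Chinese remainder theorem a further prime \<open>p > k\<close> splits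
  the class \<open>a mod q\<close> into exactly two classes modulo \<open>q * p\<close>.
\<close>
lemma card_shifted_dvd_bound:
  fixes k n q a :: nat
  assumes "finite D" "\<And>p. p \<in> D \<Longrightarrow> prime p \<and> k < p" "k > 0" "q > 0"
    "\<And>p. p \<in> D \<Longrightarrow> coprime q p"
  shows "\<bar>real (card {m\<in>{1..n}. [m = a] (mod q) \<and> (\<forall>p\<in>D. p dvd m * (m + k))})
           - n / q * (\<Prod>p\<in>D. 2 / real p)\<bar> \<le> 2 ^ card D"
  using assms
proof (induction D arbitrary: q a rule: finite_induct)
  case empty
  then show ?case using card_cong_bound[of q n a] by simp
next
  case (insert p D)
  have p: "prime p" "k < p" "coprime q p" using insert.prems by auto
  have q: "q * p > 0" using insert.prems(3) p by (simp add: prime_gt_0_nat)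
  have cop: "coprime (q * p) p'" if "p' \<in> D" for p'
  proof -
    have "p \<noteq> p'" using insert.hyps(2) that by auto
    then have "coprime p p'" using insert.prems(1)[of p'] that p by (simp add: primes_coprime)
    then show ?thesis using insert.prems(4) that by simp
  qed
  obtain x where x: "[x = a] (mod q)" "[x = 0] (mod p)"
    using binary_chinese_remainder_nat[OF p(3)] by blast
  obtain y where y: "[y = a] (mod q)" "[y = p - k] (mod p)"
    using binary_chinese_remainder_nat[OF p(3)] by blast
  have X: "[m = x] (mod q * p) \<longleftrightarrow> [m = a] (mod q) \<and> [m = 0] (mod p)" for m
    using x p(3) by (metis cong_modulus_mult_nat coprime_cong_mult_nat cong_sym cong_trans mult.commute)
  have Y: "[m = y] (mod q * p) \<longleftrightarrow> [m = a] (mod q) \<and> [m = p - k] (mod p)" for m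
    using y p(3) by (metis cong_modulus_mult_nat coprime_cong_mult_nat cong_sym cong_trans mult.commute)
  \<comment> \<open>As 0 < k < p, the classes 0 and -k are distinct modulo p; hence the density 2/p
    per prime.\<close>
  have ne: "\<not> ([m = 0] (mod p) \<and> [m = p - k] (mod p))" for m
    using p(2) \<open>k > 0\<close> by (auto simp: cong_def)
  let ?S = "\<lambda>q a D. {m\<in>{1..n}. [m = a] (mod q) \<and> (\<forall>p\<in>D. p dvd m * (m + k))}"
  have "?S q a (insert p D) = ?S (q * p) x D \<union> ?S (q * p) y D"
    using prime_dvd_shift_iff[OF p(1) \<open>k > 0\<close> p(2)] by (auto simp only: X Y)
  moreover have "?S (q * p) x D \<inter> ?S (q * p) y D = {}"
    using ne by (auto simp only: X Y)
  ultimately have c: "card (?S q a (insert p D)) = card (?S (q * p) x D) + card (?S (q * p) y D)"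
    by (simp add: card_Un_disjoint)
  have "\<bar>real (card (?S (q * p) a' D)) - n / (q * p) * (\<Prod>p\<in>D. 2 / real p)\<bar> \<le> 2 ^ card D" for a'
    using insert.IH[OF _ \<open>k > 0\<close> q, of a'] insert.prems(1) cop by simp
  \<comment> \<open>Each of the two classes carries its own rounding error, which doubles the
    bound.\<close>
  from this[of x] this[of y]
  have "\<bar>real (card (?S (q * p) x D)) + real (card (?S (q * p) y D))
      - 2 * (n / (q * p) * (\<Prod>p\<in>D. 2 / real p))\<bar> \<le> 2 * 2 ^ card D"
    unfolding abs_le_iff by argo
  then show ?case
    using insert.hyps p unfolding c by (simp add: mult_ac)
qed

section \<open>Truncated inclusion-exclusion and the sieve inequality\<close>

lemma alternating_choose_sum_nonneg:
  assumes "even r"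
  shows "(\<Sum>j\<le>r. (-1) ^ j * real (b choose j)) \<ge> of_bool (b = 0)"
proof (cases b)
  case 0
  then show ?thesis by (simp add: sum.atMost_shift)
next
  case (Suc c)
  \<comment> \<open>By Pascal's rule the truncated alternating sum telescopes to
    \<open>c choose r\<close> up to the sign (-1)^r, which is positive for even
    \<open>r\<close>.\<close>
  have "(\<Sum>j\<le>r. (-1) ^ j * real (b choose j)) = (\<Sum>j\<le>r. (real b gchoose j) * (-1) ^ j)"
    by (simp add: binomial_gbinomial mult.commute)
  also have "\<dots> = real (c choose r)"
    using assms by (simp add: gbinomial_sum_lower_neg Suc binomial_gbinomial)
  finally show ?thesis using Suc by simp
qed

text \<open>Kept general in \<open>f\<close> because it serves twice: with (-1)^j for the Bonferroni
  inequality and with 2^j for the rounding errors.\<close>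

lemma sum_subsets_card_le:
  fixes f :: "nat \<Rightarrow> real"
  assumes "finite B"
  shows "(\<Sum>D | D \<subseteq> B \<and> card D \<le> r. f (card D)) = (\<Sum>j\<le>r. f j * (card B choose j))"
proof -
  have "(\<Sum>D | D \<subseteq> B \<and> card D \<le> r. f (card D))
      = (\<Sum>j\<le>r. \<Sum>D | D \<in> {D. D \<subseteq> B \<and> card D \<le> r} \<and> card D = j. f (card D))"
    using assms by (intro sum.group[symmetric]) auto
  also have "\<dots> = (\<Sum>j\<le>r. f j * (card B choose j))"
  proof (rule sum.cong)
    fix j assume "j \<in> {..r}"
    then have "{D. D \<in> {D. D \<subseteq> B \<and> card D \<le> r} \<and> card D = j} = {D. D \<subseteq> B \<and> card D = j}"
      by auto
    then show "(\<Sum>D | D \<in> {D. D \<subseteq> B \<and> card D \<le> r} \<and> card D = j. f (card D)) = f j * (card B choose j)"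
      using assms by (simp add: n_subsets)
  qed simp
  finally show ?thesis .
qed

text \<open>Complete inclusion-exclusion gives equality; stopping after an even size overestimates.
  With \<open>B\<close> the set of sieving primes dividing \<open>m * (m + k)\<close>, this bounds
  the indicator of \<open>m\<close> surviving the sieve.\<close>

lemma bonferroni_upper:
  assumes "finite B" "even r"
  shows "of_bool (B = {}) \<le> (\<Sum>D | D \<subseteq> B \<and> card D \<le> r. (-1 :: real) ^ card D)"
  using alternating_choose_sum_nonneg[OF assms(2), of "card B"] assms
  by (simp add: sum_subsets_card_le)

lemma choose_le_power: "real (N choose j) \<le> real N ^ j"
proof -
  have "real (N choose j) * fact j \<le> real N ^ j"
    using binomial_fact_pow[of N j] by (metis of_nat_fact of_nat_le_iff of_nat_mult of_nat_power)
  moreover have "real (N choose j) * 1 \<le> real (N choose j) * fact j"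
    by (intro mult_left_mono) (simp_all add: fact_ge_1)
  ultimately show ?thesis by linarith
qed

text \<open>Termwise comparison with the binomial expansion of the right-hand side, whose
  coefficients \<open>r choose j\<close> are at least 1. The left-hand side is the total rounding
  error of the sieve.\<close>

lemma sum_subsets_two_power_le:
  assumes "finite P"
  shows "(\<Sum>D | D \<subseteq> P \<and> card D \<le> r. (2::real) ^ card D) \<le> (1 + 2 * real (card P)) ^ r"
proof -
  have "(\<Sum>D | D \<subseteq> P \<and> card D \<le> r. (2::real) ^ card D) = (\<Sum>j\<le>r. 2 ^ j * real (card P choose j))"
    using assms by (rule sum_subsets_card_le)
  also have "\<dots> \<le> (\<Sum>j\<le>r. real (r choose j) * (2 * real (card P)) ^ j * 1 ^ (r - j))"
  proof (rule sum_mono)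
    fix j assume "j \<in> {..r}"
    then have "1 \<le> real (r choose j)" using binomial_eq_0_iff[of r j] by (simp add: Suc_le_eq)
    then have *: "1 * (2 * real (card P)) ^ j \<le> real (r choose j) * (2 * real (card P)) ^ j"
      by (intro mult_right_mono) simp_all
    have "2 ^ j * real (card P choose j) \<le> 2 ^ j * real (card P) ^ j"
      by (intro mult_left_mono choose_le_power) simp
    also have "\<dots> = 1 * (2 * real (card P)) ^ j"
      by (simp add: power_mult_distrib)
    also note *
    finally show "2 ^ j * real (card P choose j) \<le> real (r choose j) * (2 * real (card P)) ^ j * 1 ^ (r - j)"
      by simp
  qed
  also have "\<dots> = (1 + 2 * real (card P)) ^ r"
    by (subst binomial_ring[symmetric]) (simp add: add.commute)
  finally show ?thesis .
qed

text \<open>Rankin's trick: the factor exp (card D - r) is at least 1 on the sets summed over, and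
  once it is inserted the sum over all subsets factors into a product. The 3 stems from e <=
  3.\<close>

lemma rankin_tail:
  fixes f :: "'a \<Rightarrow> real"
  assumes "finite P" "\<And>p. p \<in> P \<Longrightarrow> 0 \<le> f p"
  shows "(\<Sum>D | D \<subseteq> P \<and> r < card D. prod f D) \<le> exp (- real r) * exp (3 * sum f P)"
proof -
  have nn: "0 \<le> prod f D" if "D \<subseteq> P" for D
    using that assms(2) by (intro prod_nonneg) auto
  have "(\<Sum>D | D \<subseteq> P \<and> r < card D. prod f D)
      \<le> (\<Sum>D | D \<subseteq> P \<and> r < card D. exp (- real r) * (\<Prod>p\<in>D. exp 1 * f p))"
  proof (rule sum_mono)
    fix D assume D: "D \<in> {D. D \<subseteq> P \<and> r < card D}"
    have "1 * prod f D \<le> exp (real (card D) - real r) * prod f D"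
      using D nn by (intro mult_right_mono) auto
    also have "\<dots> = exp (- real r) * (\<Prod>p\<in>D. exp 1 * f p)"
      by (simp add: prod.distrib exp_diff exp_minus field_simps flip: exp_of_nat_mult)
    finally show "prod f D \<le> exp (- real r) * (\<Prod>p\<in>D. exp 1 * f p)" by simp
  qed
  also have "\<dots> \<le> (\<Sum>D\<in>Pow P. exp (- real r) * (\<Prod>p\<in>D. exp 1 * f p))"
    using assms by (intro sum_mono2 mult_nonneg_nonneg prod_nonneg) auto
  also have "\<dots> = exp (- real r) * (\<Prod>p\<in>P. exp 1 * f p + 1)"
    using assms(1) by (simp add: prod_add sum_distrib_left)
  also have "\<dots> \<le> exp (- real r) * (\<Prod>p\<in>P. exp (3 * f p))"
  proof (intro mult_left_mono prod_mono conjI)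
    fix p assume "p \<in> P"
    then have "0 \<le> f p" using assms by simp
    then show "0 \<le> exp 1 * f p + 1" by (simp add: add_nonneg_nonneg)
    have "exp 1 * f p \<le> 3 * f p" using exp_le \<open>0 \<le> f p\<close> by (intro mult_right_mono)
    then show "exp 1 * f p + 1 \<le> exp (3 * f p)" using exp_ge_add_one_self[of "3 * f p"] by linarith
  qed simp
  also have "\<dots> = exp (- real r) * exp (3 * sum f P)"
    using assms(1) by (simp add: exp_sum sum_distrib_left)
  finally show ?thesis .
qed

text \<open>Rounding errors over all subsets would add up to 3^(card P); cutting at size
  \<open>r\<close> makes them polynomial in \<open>card P\<close> for fixed \<open>r\<close>. The
  price is the tail of the main term, which Rankin's trick bounds with densities 2/p, turning the 3
  there into 6.\<close>

lemma brun_sieve: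
  fixes k n r :: nat
  assumes "finite P" "\<And>p. p \<in> P \<Longrightarrow> prime p \<and> k < p" "k > 0" "even r"
  shows "real (card {m\<in>{1..n}. \<forall>p\<in>P. \<not> p dvd m * (m + k)})
     \<le> n * (\<Prod>p\<in>P. 1 - 2 / real p) + n * (exp (- real r) * exp (6 * (\<Sum>p\<in>P. 1 / real p)))
       + (1 + 2 * real (card P)) ^ r"
proof -
  define B where "B m = {p\<in>P. p dvd m * (m + k)}" for m
  define \<D> where "\<D> = {D. D \<subseteq> P \<and> card D \<le> r}"
  define N where "N D = card {m\<in>{1..n}. \<forall>p\<in>D. p dvd m * (m + k)}" for D
  define g where "g D = (\<Prod>p\<in>D. 2 / real p)" for D :: "nat set"
  have fin: "finite \<D>" using assms(1) by (auto simp: \<D>_def)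
  have "real (card {m\<in>{1..n}. \<forall>p\<in>P. \<not> p dvd m * (m + k)})
      = (\<Sum>m\<in>{1..n}. of_bool (B m = {}))"
    by (simp add: B_def flip: of_nat_sum) (auto intro!: arg_cong[where f = card])
  also have "\<dots> \<le> (\<Sum>m\<in>{1..n}. \<Sum>D | D \<subseteq> B m \<and> card D \<le> r. (-1) ^ card D)"
    using assms by (intro sum_mono bonferroni_upper) (auto simp: B_def)
  also have "\<dots> = (\<Sum>m\<in>{1..n}. \<Sum>D\<in>\<D>. of_bool (D \<subseteq> B m) * (-1) ^ card D)"
  proof (rule sum.cong)
    fix m
    have "{D. D \<subseteq> B m \<and> card D \<le> r} = {D\<in>\<D>. D \<subseteq> B m}"
      by (auto simp: \<D>_def B_def)
    then show "(\<Sum>D | D \<subseteq> B m \<and> card D \<le> r. (-1) ^ card D)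
        = (\<Sum>D\<in>\<D>. of_bool (D \<subseteq> B m) * (-1 :: real) ^ card D)"
      using fin by (simp add: sum.inter_filter of_bool_def if_distrib[of "\<lambda>x. x * _"] cong: if_cong)
  qed simp
  also have "\<dots> = (\<Sum>D\<in>\<D>. \<Sum>m\<in>{1..n}. of_bool (D \<subseteq> B m) * (-1) ^ card D)"
    by (rule sum.swap)
  also have "\<dots> = (\<Sum>D\<in>\<D>. (-1) ^ card D * real (N D))"
  proof (rule sum.cong)
    fix D assume "D \<in> \<D>"
    then have "{m\<in>{1..n}. \<forall>p\<in>D. p dvd m * (m + k)} = {1..n} \<inter> {m. D \<subseteq> B m}"
      by (auto simp: \<D>_def B_def)
    then show "(\<Sum>m\<in>{1..n}. of_bool (D \<subseteq> B m) * (-1) ^ card D) = (-1) ^ card D * real (N D)"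
      by (simp add: N_def flip: sum_distrib_right)
  qed simp
  also have "\<dots> \<le> (\<Sum>D\<in>\<D>. (-1) ^ card D * (n * g D) + 2 ^ card D)"
  proof (rule sum_mono)
    fix D assume "D \<in> \<D>"
    then have "finite D" "\<And>p. p \<in> D \<Longrightarrow> prime p \<and> k < p"
      using assms by (auto simp: \<D>_def intro: finite_subset)
    \<comment> \<open>Modulus 1 and residue 0 make the congruence vacuous.\<close>
    from card_shifted_dvd_bound[OF this \<open>k > 0\<close>, of 1 n 0]
    have "\<bar>real (N D) - n * g D\<bar> \<le> 2 ^ card D"
      by (simp add: N_def g_def)
    then show "(-1) ^ card D * real (N D) \<le> (-1) ^ card D * (n * g D) + 2 ^ card D"
      by (cases "even (card D)") auto
  qed
  also have "\<dots> = n * (\<Sum>D\<in>\<D>. (-1) ^ card D * g D) + (\<Sum>D\<in>\<D>. 2 ^ card D)"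
    by (simp add: sum.distrib sum_distrib_left mult_ac)
  also have "(\<Sum>D\<in>\<D>. (-1) ^ card D * g D)
      \<le> (\<Prod>p\<in>P. 1 - 2 / real p) + exp (- real r) * exp (3 * (\<Sum>p\<in>P. 2 / real p))"
  proof -
    \<comment> \<open>The full product is the same alternating sum over all subsets, so the
      truncated sum differs from it by the sets larger than \<open>r\<close>.\<close>
    have "(\<Prod>p\<in>P. 1 - 2 / real p) = (\<Sum>D\<in>Pow P. (-1) ^ card D * g D)"
      by (simp add: prod_diff_conv_sum[OF assms(1)] g_def)
    also have "\<dots> = (\<Sum>D\<in>\<D>. (-1) ^ card D * g D)
        + (\<Sum>D | D \<subseteq> P \<and> r < card D. (-1) ^ card D * g D)"
      using assms(1) by (subst sum.union_disjoint[symmetric]) (auto simp: \<D>_def intro!: sum.cong)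
    finally have main: "(\<Sum>D\<in>\<D>. (-1) ^ card D * g D) = (\<Prod>p\<in>P. 1 - 2 / real p)
        - (\<Sum>D | D \<subseteq> P \<and> r < card D. (-1) ^ card D * g D)" by simp
    have "- (\<Sum>D | D \<subseteq> P \<and> r < card D. (-1) ^ card D * g D)
        \<le> (\<Sum>D | D \<subseteq> P \<and> r < card D. g D)"
      unfolding sum_negf[symmetric]
    proof (rule sum_mono)
      fix D
      have "0 \<le> g D" by (simp add: g_def prod_nonneg)
      then show "- ((-1) ^ card D * g D) \<le> g D" by (cases "even (card D)") auto
    qed
    also have "\<dots> \<le> exp (- real r) * exp (3 * (\<Sum>p\<in>P. 2 / real p))"
      unfolding g_def using assms(1) by (rule rankin_tail) simp
    finally show ?thesis using main by linarith
  qed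
  also have "3 * (\<Sum>p\<in>P. 2 / real p) = 6 * (\<Sum>p\<in>P. 1 / real p)"
    by (simp add: sum_distrib_left)
  also have "(\<Sum>D\<in>\<D>. (2::real) ^ card D) \<le> (1 + 2 * real (card P)) ^ r"
    unfolding \<D>_def using assms(1) by (rule sum_subsets_two_power_le)
  finally show ?thesis by (simp add: mult_left_mono distrib_left)
qed

section \<open>Mertens-type bounds for products over primes\<close>

lemma sum_inverse_smooth_le_prod:
  assumes "finite P" "\<And>p. p \<in> P \<Longrightarrow> prime p"
  shows "(\<Sum>m | m \<in> {1..N} \<and> prime_factors m \<subseteq> P. 1 / real m) \<le> (\<Prod>p\<in>P. 1 / (1 - 1 / real p))"
  using assms
proof (induction P rule: finite_induct)
  case empty
  have "{m. m \<in> {1..N} \<and> prime_factors m \<subseteq> {}} \<subseteq> {1::nat}"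
    by (auto simp: prime_factorization_empty_iff)
  then have "(\<Sum>m | m \<in> {1..N} \<and> prime_factors m \<subseteq> {}. 1 / real m) \<le> (\<Sum>m\<in>{1::nat}. 1 / real m)"
    by (intro sum_mono2) auto
  then show ?case by simp
next
  case (insert p P)
  have p: "prime p" using insert.prems by simp
  then have "p > 1" by (rule prime_gt_1_nat)
  note p = p this
  let ?S = "\<lambda>P. {m. m \<in> {1..N} \<and> prime_factors m \<subseteq> P}"
  \<comment> \<open>Euler's product, one prime at a time: splitting off the exact power of
    \<open>p\<close> reduces to \<open>P\<close>, and the sum over the exponent is geometric.
    Exponents up to \<open>N\<close> suffice since a < 2^a <= p^a <= m.\<close>
  have sub: "?S (insert p P) \<subseteq> (\<lambda>(a, m). p ^ a * m) ` ({..N} \<times> ?S P)"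
  proof
    fix m assume m: "m \<in> ?S (insert p P)"
    define a where "a = multiplicity p m"
    obtain m' where m': "m = p ^ a * m'" "\<not> p dvd m'"
      using multiplicity_decompose'[of m p] m p by (auto simp: a_def)
    have pos: "m' > 0" "p ^ a > 0" using m m' p by (auto intro!: gr0I)
    have "a < 2 ^ a" by (rule less_exp)
    also have "\<dots> \<le> p ^ a" using p by (intro power_mono) auto
    also have "p ^ a * 1 \<le> p ^ a * m'" using pos by (intro mult_left_mono) simp_all
    then have "p ^ a \<le> m" using m' by simp
    finally have "a \<le> N" using m by simp
    have "prime_factors m' \<subseteq> prime_factors m"
      using m m' pos by (intro dvd_prime_factors) auto
    then have "prime_factors m' \<subseteq> P" using m m' by (auto simp: in_prime_factors_iff)
    moreover have "1 * m' \<le> p ^ a * m'" using pos by (intro mult_right_mono) (simp_all add: Suc_le_eq)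
    then have "m' \<le> m" using m' by simp
    ultimately have "m' \<in> ?S P" using m pos by auto
    then show "m \<in> (\<lambda>(a, m). p ^ a * m) ` ({..N} \<times> ?S P)"
      using m'(1) \<open>a \<le> N\<close> by (intro image_eqI[of _ _ "(a, m')"]) auto
  qed
  have "(\<Sum>m\<in>?S (insert p P). 1 / real m) \<le> (\<Sum>m\<in>(\<lambda>(a, m). p ^ a * m) ` ({..N} \<times> ?S P). 1 / real m)"
    using sub by (intro sum_mono2) auto
  also have "\<dots> \<le> (\<Sum>(a, m)\<in>{..N} \<times> ?S P. 1 / real (p ^ a * m))"
    by (rule order_trans[OF sum_image_le]) (auto simp: case_prod_beta)
  also have "\<dots> = (\<Sum>a\<le>N. (1 / real p) ^ a) * (\<Sum>m\<in>?S P. 1 / real m)"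
    by (simp add: sum_product sum.cartesian_product power_one_over)
  also have "\<dots> \<le> 1 / (1 - 1 / real p) * (\<Prod>p\<in>P. 1 / (1 - 1 / real p))"
  proof (intro mult_mono insert.IH)
    show "(\<Sum>a\<le>N. (1 / real p) ^ a) \<le> 1 / (1 - 1 / real p)"
      using p sum_le_suminf[of "\<lambda>a. (1 / real p) ^ a" "{..N}"]
      by (simp add: suminf_geometric summable_geometric)
  qed (use p insert.prems in \<open>auto intro!: sum_nonneg\<close>)
  finally show ?case using insert.hyps by simp
qed

text \<open>Every m up to \<open>N\<close> has only prime factors up to \<open>N\<close>, so the
  Euler product dominates the harmonic sum and thus the logarithm.\<close>

lemma prod_primes_le_inverse_ln:
  assumes "N \<ge> 1"
  shows "(\<Prod>p | prime p \<and> p \<le> N. 1 - 1 / real p) \<le> 1 / ln (real N + 1)"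
proof -
  let ?P = "{p. prime p \<and> p \<le> N}"
  have fin: "finite ?P" by simp
  have "ln (real N + 1) \<le> harm N" by (rule ln_le_harm)
  also have "\<dots> = (\<Sum>m | m \<in> {1..N} \<and> prime_factors m \<subseteq> ?P. 1 / real m)"
    unfolding harm_def
    by (intro sum.cong) (auto simp: in_prime_factors_iff inverse_eq_divide intro: order_trans[OF dvd_imp_le])
  also have "\<dots> \<le> (\<Prod>p\<in>?P. 1 / (1 - 1 / real p))"
    by (rule sum_inverse_smooth_le_prod) auto
  also have "\<dots> = 1 / (\<Prod>p\<in>?P. 1 - 1 / real p)"
    by (simp add: prod_dividef)
  finally have "ln (real N + 1) \<le> 1 / (\<Prod>p\<in>?P. 1 - 1 / real p)" .
  moreover have "(\<Prod>p\<in>?P. 1 - 1 / real p) > 0"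
    by (intro prod_pos) (auto dest: prime_gt_1_nat)
  ultimately show ?thesis using assms by (simp add: field_simps)
qed

text \<open>Since 1 - 2/p <= (1 - 1/p)^2, the square of the previous product bounds this one;
  leaving out the primes up to \<open>K\<close> costs only the constant 1 / c^2.\<close>

lemma prod_one_minus_two_div_le:
  assumes "K \<ge> 2"
  shows "\<exists>C>0. \<forall>N\<ge>1. (\<Prod>p | prime p \<and> K < p \<and> p \<le> N. 1 - 2 / real p) \<le> C / (ln (real N + 1))\<^sup>2"
proof -
  define c where "c = (\<Prod>p | prime p \<and> p \<le> K. 1 - 1 / real p)"
  have c: "c > 0" unfolding c_def
    by (intro prod_pos) (auto dest: prime_gt_1_nat)
  have "(\<Prod>p | prime p \<and> K < p \<and> p \<le> N. 1 - 2 / real p) \<le> (1 / c\<^sup>2) / (ln (real N + 1))\<^sup>2"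
    if "N \<ge> 1" for N
  proof -
    let ?P = "{p. prime p \<and> K < p \<and> p \<le> N}"
    let ?Q = "{p. prime p \<and> p \<le> K \<and> p \<le> N}"
    define x where "x = (\<Prod>p\<in>?P. 1 - 1 / real p)"
    have "{p. prime p \<and> p \<le> N} = ?P \<union> ?Q" by auto
    then have eq: "(\<Prod>p | prime p \<and> p \<le> N. 1 - 1 / real p) = x * (\<Prod>p\<in>?Q. 1 - 1 / real p)"
      unfolding x_def by (subst prod.union_disjoint[symmetric]) auto
    \<comment> \<open>\<open>c\<close> runs over all primes up to \<open>K\<close>, also those above
      \<open>N\<close>. These extra factors are at most 1, so \<open>c\<close> is a lower bound
      uniform in \<open>N\<close>.\<close>
    have "c = (\<Prod>p | prime p \<and> p \<le> K \<and> N < p. 1 - 1 / real p) * (\<Prod>p\<in>?Q. 1 - 1 / real p)"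
      unfolding c_def by (subst prod.union_disjoint[symmetric]) (auto intro!: prod.cong)
    also have "\<dots> \<le> 1 * (\<Prod>p\<in>?Q. 1 - 1 / real p)"
      by (intro mult_right_mono prod_le_1 prod_nonneg) (auto dest: prime_gt_1_nat)
    finally have "c \<le> (\<Prod>p\<in>?Q. 1 - 1 / real p)" by simp
    moreover have x: "x \<ge> 0" unfolding x_def
      by (intro prod_nonneg) (auto dest: prime_gt_1_nat)
    ultimately have "x * c \<le> x * (\<Prod>p\<in>?Q. 1 - 1 / real p)" by (intro mult_left_mono)
    then have le: "x * c \<le> 1 / ln (real N + 1)"
      using prod_primes_le_inverse_ln[OF that] eq by linarith
    have "(\<Prod>p\<in>?P. 1 - 2 / real p) \<le> (\<Prod>p\<in>?P. (1 - 1 / real p)\<^sup>2)"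
    proof (intro prod_mono conjI)
      fix p assume "p \<in> ?P"
      then show "0 \<le> 1 - 2 / real p" using \<open>K \<ge> 2\<close> by (simp add: field_simps)
      show "1 - 2 / real p \<le> (1 - 1 / real p)\<^sup>2" by (simp add: power2_eq_square algebra_simps)
    qed
    also have "\<dots> = x\<^sup>2" by (simp add: x_def prod_power_distrib)
    also have "\<dots> = (x * c)\<^sup>2 / c\<^sup>2" using c by (simp add: power_mult_distrib)
    also have "\<dots> \<le> (1 / ln (real N + 1))\<^sup>2 / c\<^sup>2"
      using x c le by (intro divide_right_mono power_mono) auto
    finally show ?thesis by (simp add: power_divide mult.commute)
  qed
  with c show ?thesis by (intro exI[of _ "1 / c\<^sup>2"]) auto
qed

section \<open>Sums of reciprocals of primes\<close>

lemma harm_le_ln: "N \<ge> 1 \<Longrightarrow> harm N \<le> 1 + ln (real N)"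
  using euler_mascheroni_sequence_decreasing[of 1 N] by (simp add: harm_expand)

text \<open>Unique factorisation leaves only the two orders of one pair. This bounds how often an
  integer occurs as a denominator when the sum of 1/p is squared.\<close>

lemma card_prime_factorisations_le:
  assumes "\<And>p. p \<in> P \<Longrightarrow> prime (p::nat)"
  shows "card {x\<in>P \<times> P. fst x * snd x = m} \<le> 2"
proof (cases "{x\<in>P \<times> P. fst x * snd x = m} = {}")
  case False
  then obtain p q where pq: "p \<in> P" "q \<in> P" "p * q = m" by auto
  have pr: "prime p" "prime q" using pq assms by auto
  have "{x\<in>P \<times> P. fst x * snd x = m} \<subseteq> {(p, q), (q, p)}"
  proof
    fix x assume "x \<in> {x\<in>P \<times> P. fst x * snd x = m}"
    then obtain a b where x: "x = (a, b)" "prime a" "prime b" "a * b = p * q"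
      using assms pq by auto
    have "a dvd p * q" using x(4) by (metis dvd_triv_left)
    then have "a = p \<or> a = q"
      using x(2) pr by (auto simp: prime_dvd_mult_iff dest: primes_dvd_imp_eq)
    then show "x \<in> {(p, q), (q, p)}" using x pr by auto
  qed
  then have "card {x\<in>P \<times> P. fst x * snd x = m} \<le> card {(p, q), (q, p)}"
    by (rule card_mono[rotated]) simp
  also have "\<dots> \<le> 2" by (cases "p = q") auto
  finally show ?thesis .
next
  case True
  show ?thesis unfolding True by simp
qed

text \<open>
  A cheap substitute for Mertens' theorem; for the sieve it is enough that the sum of \<open>1 / p\<close> up
  to \<open>N\<close> is \<open>o(ln N)\<close>.
\<close>
lemma sum_inverse_primes_square_le:
  assumes "\<And>p. p \<in> P \<Longrightarrow> prime p \<and> p \<le> N"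
  shows "(\<Sum>p\<in>P. 1 / real p)\<^sup>2 \<le> 2 * harm (N\<^sup>2)"
proof -
  have fin: "finite P" using assms by (intro finite_subset[of P "{..N}"]) auto
  have img: "(\<lambda>x. fst x * snd x) ` (P \<times> P) \<subseteq> {1..N\<^sup>2}"
  proof (rule image_subsetI)
    fix x assume "x \<in> P \<times> P"
    then have x: "prime (fst x)" "fst x \<le> N" "prime (snd x)" "snd x \<le> N" using assms by auto
    then have "fst x * snd x \<le> N * N" by (intro mult_mono) auto
    moreover have "0 < fst x * snd x" using x by (simp add: prime_gt_0_nat)
    ultimately show "fst x * snd x \<in> {1..N\<^sup>2}" by (simp add: power2_eq_square Suc_le_eq)
  qed
  \<comment> \<open>Squaring produces the terms 1/(pq). Grouped by the product m, which is at most
    N^2, they hit each 1/m at most twice, so the square is compared with a harmonic sum.\<close>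
  have "(\<Sum>p\<in>P. 1 / real p)\<^sup>2 = (\<Sum>x\<in>P \<times> P. 1 / real (fst x * snd x))"
    by (simp add: power2_eq_square sum_product sum.cartesian_product case_prod_beta)
  also have "\<dots> = (\<Sum>m\<in>{1..N\<^sup>2}. \<Sum>x | x \<in> P \<times> P \<and> fst x * snd x = m. 1 / real (fst x * snd x))"
    using fin img by (intro sum.group[symmetric]) simp_all
  also have "\<dots> = (\<Sum>m\<in>{1..N\<^sup>2}. real (card {x\<in>P \<times> P. fst x * snd x = m}) * (1 / real m))"
    by (intro sum.cong) auto
  also have "\<dots> \<le> (\<Sum>m\<in>{1..N\<^sup>2}. 2 * (1 / real m))"
  proof (intro sum_mono mult_right_mono)
    fix m
    show "real (card {x\<in>P \<times> P. fst x * snd x = m}) \<le> 2"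
      using card_prime_factorisations_le[of P m] assms by force
  qed auto
  also have "\<dots> = 2 * harm (N\<^sup>2)"
    by (simp add: harm_def sum_distrib_left inverse_eq_divide)
  finally show ?thesis .
qed

section \<open>Counting prime pairs with a given difference\<close>

lemma card_prime_pairs_le:
  fixes k :: nat
  assumes "k > 0"
  shows "\<exists>C>0. \<forall>s\<ge>1. \<forall>n::nat. real (card {p\<in>{1..n}. prime p \<and> prime (p + k)})
           \<le> C * real n / s ^ 4 + 2 * exp (72 * s ^ 3)"
proof -
  \<comment> \<open>Sieving primes must exceed \<open>k\<close>, so that 0 and -k are different
    classes; the 2 is what the product bound asks for.\<close>
  define K where "K = max 2 k"
  obtain C where C: "C > 0"
    "\<And>N. N \<ge> 1 \<Longrightarrow> (\<Prod>p | prime p \<and> K < p \<and> p \<le> N. 1 - 2 / real p) \<le> C / (ln (real N + 1))\<^sup>2"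
    using prod_one_minus_two_div_le[of K] by (auto simp: K_def)
  have "real (card {p\<in>{1..n}. prime p \<and> prime (p + k)}) \<le> (C + 1) * n / s ^ 4 + 2 * exp (72 * s ^ 3)"
    if s: "s \<ge> 1" for s :: real and n :: nat
  proof -
    \<comment> \<open>Sieving up to \<open>N\<close> with \<open>ln N \<approx> s\<^sup>2\<close> has \<open>\<Sum>1/p \<le> 3 * s\<close>, so truncating at degree \<open>r \<approx> 22 * s\<close>
      loses only \<open>exp (- 4 * s)\<close>.\<close>
    define N where "N = nat \<lfloor>exp (s\<^sup>2)\<rfloor>"
    define P where "P = {p. prime p \<and> K < p \<and> p \<le> N}"
    define r where "r = 2 * nat \<lceil>11 * s\<rceil>"
    have N_le: "real N \<le> exp (s\<^sup>2)" by (simp add: N_def)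
    have N_ge: "exp (s\<^sup>2) \<le> real N + 1" unfolding N_def by linarith
    have N1: "N \<ge> 1" unfolding N_def by (simp add: le_nat_iff)
    have "ln (real N) \<le> ln (exp (s\<^sup>2))"
      using N_le N1 by (subst ln_le_cancel_iff) auto
    then have lnN: "s\<^sup>2 \<le> ln (real N + 1)" "ln (real N) \<le> s\<^sup>2"
      using N_ge by (simp_all add: ln_ge_iff)
    have fin: "finite P" by (simp add: P_def)
    have r: "even r" "22 * s \<le> real r" "real r \<le> 24 * s"
      using s unfolding r_def by (simp, linarith+)
    have "s * 1 \<le> s * s" "s * s * 1 \<le> s * s * s" using s by (intro mult_left_mono; simp)+
    then have sq: "s \<le> s * s" "s * s \<le> s * s * s" "1 \<le> s * s" using s by linarith+
    \<comment> \<open>If a sieving prime \<open>p\<close> divides \<open>m * (m + k)\<close> with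
      both factors prime, it equals one of them, and either way m <= p <= N. Pairs lost to the sieve
      therefore cost at most \<open>N\<close>.\<close>
    have sub: "{p\<in>{1..n}. prime p \<and> prime (p + k)} \<subseteq> {1..N} \<union> {m\<in>{1..n}. \<forall>p\<in>P. \<not> p dvd m * (m + k)}"
    proof (rule subsetI, rule UnCI)
      fix m assume m: "m \<in> {p\<in>{1..n}. prime p \<and> prime (p + k)}" "m \<notin> {m\<in>{1..n}. \<forall>p\<in>P. \<not> p dvd m * (m + k)}"
      then obtain p where p: "p \<in> P" "p dvd m * (m + k)" by auto
      then have "p = m \<or> p = m + k"
        using m by (auto simp: P_def prime_dvd_mult_iff primes_dvd_imp_eq)
      then show "m \<in> {1..N}" using p m by (auto simp: P_def)
    qed
    have "card {p\<in>{1..n}. prime p \<and> prime (p + k)} \<le> N + card {m\<in>{1..n}. \<forall>p\<in>P. \<not> p dvd m * (m + k)}"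
      using order_trans[OF card_mono[OF _ sub] card_Un_le] by simp
    then have "real (card {p\<in>{1..n}. prime p \<and> prime (p + k)})
        \<le> N + real (card {m\<in>{1..n}. \<forall>p\<in>P. \<not> p dvd m * (m + k)})" by linarith
    also have "real (card {m\<in>{1..n}. \<forall>p\<in>P. \<not> p dvd m * (m + k)})
       \<le> n * (\<Prod>p\<in>P. 1 - 2 / real p) + n * (exp (- real r) * exp (6 * (\<Sum>p\<in>P. 1 / real p)))
       + (1 + 2 * real (card P)) ^ r"
      using fin r assms by (intro brun_sieve) (auto simp: P_def K_def)
    also have "(\<Prod>p\<in>P. 1 - 2 / real p) \<le> C / s ^ 4"
    proof -
      have "(s\<^sup>2)\<^sup>2 \<le> (ln (real N + 1))\<^sup>2" using lnN by (intro power_mono) auto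
      then have "C / (ln (real N + 1))\<^sup>2 \<le> C / s ^ 4"
        using C s N1 by (intro divide_left_mono mult_pos_pos) (auto simp flip: power_mult)
      then show ?thesis using C(2)[OF N1] by (simp add: P_def)
    qed
    also have "exp (- real r) * exp (6 * (\<Sum>p\<in>P. 1 / real p)) \<le> 1 / s ^ 4"
    proof -
      define S where "S = (\<Sum>p\<in>P. 1 / real p)"
      have "S\<^sup>2 \<le> 2 * harm (N\<^sup>2)"
        unfolding S_def by (rule sum_inverse_primes_square_le) (auto simp: P_def)
      also have "\<dots> \<le> 2 * (1 + ln (real (N\<^sup>2)))"
        using N1 by (intro mult_left_mono harm_le_ln) auto
      also have "\<dots> \<le> 2 * (1 + 2 * s\<^sup>2)"
        using lnN N1 by (simp add: ln_realpow)
      also have "\<dots> \<le> (3 * s)\<^sup>2" using sq(3) by (simp add: power2_eq_square)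
      finally have "S \<le> 3 * s" using s by (auto intro: power2_le_imp_le)
      then have "exp (- real r) * exp (6 * S) \<le> exp (- (4 * s))"
        using r by (simp flip: exp_add)
      also have "\<dots> = 1 / exp s ^ 4" by (simp add: exp_minus field_simps flip: exp_of_nat_mult)
      also have "\<dots> \<le> 1 / s ^ 4"
      proof -
        have "s \<le> exp s" using exp_ge_add_one_self[of s] by linarith
        then show ?thesis using s by (intro divide_left_mono power_mono mult_pos_pos) auto
      qed
      finally show ?thesis by (simp add: S_def)
    qed
    \<comment> \<open>Origin of 72: the base is at most 3 exp (s^2) <= exp (3 s^2), because 3 <= 1 +
      2 s^2, and the exponent \<open>r\<close> is at most 24 s.\<close>
    also have "(1 + 2 * real (card P)) ^ r \<le> exp (72 * s ^ 3)"
    proof -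
      have "card P \<le> card {1..N}"
        by (intro card_mono) (auto simp: P_def dest: prime_gt_0_nat)
      then have "1 + 2 * real (card P) \<le> 3 * exp (s\<^sup>2)"
        using N_le N1 by simp
      also have "\<dots> \<le> exp (2 * s\<^sup>2) * exp (s\<^sup>2)"
        using exp_ge_add_one_self[of "2 * s\<^sup>2"] sq(3)
        unfolding power2_eq_square by (intro mult_right_mono; linarith?) simp
      also have "\<dots> = exp (3 * s\<^sup>2)" by (simp flip: exp_add)
      finally have "(1 + 2 * real (card P)) ^ r \<le> exp (3 * s\<^sup>2) ^ r"
        by (intro power_mono) auto
      also have "\<dots> = exp (real r * (3 * s\<^sup>2))" by (simp add: exp_of_nat_mult)
      also have "\<dots> \<le> exp (24 * s * (3 * s\<^sup>2))"
        unfolding exp_le_cancel_iff using r by (intro mult_right_mono) simp_all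
      finally show ?thesis by (simp add: power2_eq_square power3_eq_cube mult.assoc)
    qed
    also have "real N \<le> exp (72 * s ^ 3)"
    proof -
      have "s\<^sup>2 \<le> 72 * s ^ 3" using sq s by (simp add: power2_eq_square power3_eq_cube)
      then show ?thesis using N_le by (meson exp_le_cancel_iff order_trans)
    qed
    finally show ?thesis
      by (simp add: mult_right_mono add_divide_distrib algebra_simps)
  qed
  with C(1) show ?thesis by (intro exI[of _ "C + 1"]) auto
qed

lemma card_prime_pairs_tendsto:
  fixes k :: nat
  assumes "k > 0"
  shows "(\<lambda>n::nat. real (card {p\<in>{1..n}. prime p \<and> prime (p + k)}) * ln n / n) \<longlonglongrightarrow> 0"
proof -
  obtain C where C: "C > 0" "\<And>s (n::nat). s \<ge> 1 \<Longrightarrow> real (card {p\<in>{1..n}. prime p \<and> prime (p + k)})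
           \<le> C * real n / s ^ 4 + 2 * exp (72 * s ^ 3)"
    using card_prime_pairs_le[OF assms] by blast
  \<comment> \<open>As 144 = 2 * 72, the remainder exp (72 s^3) becomes \<open>sqrt n\<close>. The
    saving s^4 is a constant times (ln n)^(4/3), which outgrows the factor \<open>ln n\<close> of
    the claim.\<close>
  define s where "s n = (ln (real n) / 144) powr (1 / 3)" for n
  have "\<forall>\<^sub>F n in sequentially. 1 \<le> s n" unfolding s_def by real_asymp
  moreover have "\<forall>\<^sub>F n::nat in sequentially. n \<ge> 2" by (rule eventually_ge_at_top)
  ultimately have "\<forall>\<^sub>F n in sequentially. norm (real (card {p\<in>{1..n}. prime p \<and> prime (p + k)}) * ln n / n)
      \<le> (C * n / (ln n / 144) powr (4 / 3) + 2 * sqrt n) * ln n / n"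
  proof eventually_elim
    case (elim n)
    have pos: "ln (real n) / 144 > 0" using elim by simp
    have "s n ^ 4 = (ln n / 144) powr (4 / 3)" "exp (72 * s n ^ 3) = exp (72 * (ln n / 144))"
      using pos unfolding s_def by (simp_all add: powr_power)
    moreover have "exp (72 * (ln (real n) / 144)) = sqrt n"
    proof -
      have "exp (72 * (ln (real n) / 144)) = exp (ln (sqrt n))" using elim by (simp add: ln_sqrt)
      then show ?thesis using elim by simp
    qed
    ultimately have "real (card {p\<in>{1..n}. prime p \<and> prime (p + k)})
        \<le> C * n / (ln n / 144) powr (4 / 3) + 2 * sqrt n"
      using C(2)[of "s n" n] elim by (simp only:)
    then show ?case
      using elim by (simp add: divide_right_mono mult_right_mono)
  qed
  moreover have "(\<lambda>n. (C * n / (ln (real n) / 144) powr (4 / 3) + 2 * sqrt n) * ln n / n) \<longlonglongrightarrow> 0"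
    using C(1) by real_asymp
  ultimately show ?thesis by (rule Lim_null_comparison)
qed

subsection \<open>A lower bound for the number of primes\<close>

text \<open>
  The numbers \<open>1 / ((n + 1) * (n choose k))\<close> form Leibniz's harmonic triangle, in which each entry is
  a difference of two entries with smaller \<open>k\<close>.
\<close>
lemma Suc_times_binomial_quotient_Ints:
  fixes L n k :: nat
  assumes "k \<le> n" "\<And>i. i \<in> {1..Suc n} \<Longrightarrow> i dvd L"
  shows "real L / (real (Suc n) * real (n choose k)) \<in> \<int>"
  using assms
proof (induction k arbitrary: n)
  case 0
  then have "Suc n dvd L" by auto
  then have "real L / real (Suc n) = real (L div Suc n)" by (simp only: real_of_nat_div)
  then show ?case by (simp only: binomial_n_0 of_nat_1 mult_1_right Ints_of_nat)
next
  case (Suc k)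
  then obtain m where n: "n = Suc m" "k \<le> m" by (cases n) auto
  define X where "X = real (m choose k)"
  have X: "X > 0" using n by (simp add: X_def)
  have c1: "real (Suc m choose Suc k) = real (Suc m) * X / real (Suc k)"
    using Suc_times_binomial_eq[of m k] unfolding X_def
    by (simp add: field_simps flip: of_nat_mult of_nat_Suc del: of_nat_Suc)
  have "(Suc m - k) * (Suc m choose k) = Suc m * (m choose k)"
    using binomial_absorb_comp[of "Suc m" k] by simp
  then have "(real (Suc m) - real k) * real (Suc m choose k) = real (Suc m) * X"
    using n unfolding X_def by (metis of_nat_diff of_nat_mult le_SucI)
  then have c2: "real (Suc m choose k) = real (Suc m) * X / (real (Suc m) - real k)"
    using n by (simp add: field_simps)
  have "real L / (real (Suc n) * real (n choose Suc k))
      = real L / (real (Suc m) * X) - real L / (real (Suc n) * real (n choose k))"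
    unfolding n(1) c1 c2 using X n(2) by (simp add: divide_simps) (simp add: algebra_simps)
  moreover have "real L / (real (Suc m) * X) \<in> \<int>"
    unfolding X_def using Suc.prems n by (intro Suc.IH) auto
  moreover have "real L / (real (Suc n) * real (n choose k)) \<in> \<int>"
    using Suc.prems n by (intro Suc.IH) auto
  ultimately show ?case by simp
qed

text \<open>\<open>L\<close> divided by (n + 1) times a binomial coefficient of row \<open>n\<close>
  is a positive integer, so at least 1. Adding the resulting bounds on the n + 1 coefficients of the
  row, whose sum is 2^n, gives the claim.\<close>

lemma power_two_le_common_multiple:
  assumes "L > 0" "\<And>i. i \<in> {1..Suc n} \<Longrightarrow> i dvd L"
  shows "(2::real) ^ n \<le> real L"
proof -
  have le: "real (n choose k) \<le> real L / real (Suc n)" if "k \<le> n" for k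
  proof -
    have pos: "real (Suc n) * real (n choose k) > 0" using that by simp
    then have "0 < real L / (real (Suc n) * real (n choose k))" using assms(1) by simp
    then have "1 \<le> real L / (real (Suc n) * real (n choose k))"
      using Ints_nonzero_abs_ge1[OF Suc_times_binomial_quotient_Ints[OF that assms(2)]] by linarith
    then show ?thesis using pos by (simp add: field_simps)
  qed
  have "(2::real) ^ n = (\<Sum>k\<le>n. real (n choose k))"
    by (simp add: choose_row_sum flip: of_nat_sum)
  also have "\<dots> \<le> (\<Sum>k\<le>n. real L / real (Suc n))"
    by (intro sum_mono le) simp
  also have "\<dots> = real L" by (simp add: field_simps)
  finally show ?thesis .
qed

text \<open>Chebyshev's lower bound via the least common multiple \<open>L\<close> of 1..n: it is at
  least 2^(n-1) as a common multiple, and at most n to the number of primes as a product of prime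
  powers not exceeding n.\<close>

lemma prime_counting_lower_bound:
  assumes "n \<ge> 2"
  shows "real (n - 1) * ln 2 \<le> real (card {p. prime p \<and> p \<le> n}) * ln n"
proof -
  let ?P = "{p. prime p \<and> p \<le> n}"
  define E where "E p = (GREATEST e. p ^ e \<le> n)" for p :: nat
  define L where "L = (\<Prod>p\<in>?P. p ^ E p)"
  \<comment> \<open>Admissible exponents are at most \<open>n\<close>, so the
    \<open>GREATEST\<close> in \<open>E\<close> is attained.\<close>
  have bound: "e \<le> n" if "p > 1" "p ^ e \<le> n" for p e :: nat
  proof -
    have "e < 2 ^ e" by (rule less_exp)
    also have "2 ^ e \<le> p ^ e" using that by (intro power_mono) auto
    finally show ?thesis using that by simp
  qed
  have E: "p ^ E p \<le> n" if "prime p" for p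
    unfolding E_def using assms bound[OF prime_gt_1_nat[OF that]]
    by (intro GreatestI_nat[of "\<lambda>e. p ^ e \<le> n" 0 n]) auto
  have E_ge: "e \<le> E p" if "prime p" "p ^ e \<le> n" for p e
    unfolding E_def using that bound[OF prime_gt_1_nat[OF that(1)]]
    by (intro Greatest_le_nat[of "\<lambda>e. p ^ e \<le> n" e n]) auto
  have "L > 0" unfolding L_def by (intro prod_pos) (auto intro: prime_gt_0_nat)
  have "i dvd L" if i: "i \<in> {1..n}" for i
  proof -
    have "i = (\<Prod>p\<in>prime_factors i. p ^ multiplicity p i)"
      using i by (intro prime_factorization_nat) auto
    also have "\<dots> dvd (\<Prod>p\<in>prime_factors i. p ^ E p)"
    proof (intro prod_dvd_prod le_imp_power_dvd E_ge)
      fix p assume p: "p \<in> prime_factors i"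
      then show "prime p" by auto
      have "p ^ multiplicity p i \<le> i"
        using i by (intro dvd_imp_le multiplicity_dvd) auto
      then show "p ^ multiplicity p i \<le> n" using i by simp
    qed
    also have "\<dots> dvd L"
      unfolding L_def using i
      by (intro prod_dvd_prod_subset)
         (auto simp: in_prime_factors_iff intro: order_trans[OF dvd_imp_le])
    finally show ?thesis .
  qed
  then have "(2::real) ^ (n - 1) \<le> real L"
    using assms \<open>L > 0\<close> by (intro power_two_le_common_multiple) auto
  also have "\<dots> \<le> (\<Prod>p\<in>?P. real n)"
    unfolding L_def of_nat_prod using E
    by (intro prod_mono) (auto simp flip: of_nat_power)
  also have "\<dots> = real n ^ card ?P" by simp
  finally have "ln ((2::real) ^ (n - 1)) \<le> ln (real n ^ card ?P)"
    using assms by (subst ln_le_cancel_iff) auto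
  then show ?thesis using assms by (simp add: ln_realpow)
qed

subsection \<open>The Fourier transform of the Dirac measure\<close>

lemma Cc_bounded:
  assumes "f \<in> Cc"
  obtains M where "M > 0" "\<And>x. norm (f x) \<le> M"
proof -
  obtain K where K: "compact K" "\<And>x. x \<notin> K \<Longrightarrow> f x = 0" and c: "continuous_on UNIV f"
    using assms by (auto simp: Cc_def)
  have "compact (f ` K)"
    using K c by (intro compact_continuous_image) (auto intro: continuous_on_subset)
  then obtain M where M: "M > 0" "\<forall>y\<in>f ` K. norm y \<le> M"
    using compact_imp_bounded bounded_pos by blast
  show thesis
  proof (rule that[OF M(1)])
    show "norm (f x) \<le> M" for x using M K(2)[of x] by (cases "x \<in> K") auto
  qed
qed

lemma Cc_measurable: "f \<in> Cc \<Longrightarrow> f \<in> borel_measurable borel"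
  by (auto simp: Cc_def intro: borel_measurable_continuous_onI)

lemma Cc_integrable:
  assumes "f \<in> Cc"
  shows "integrable lborel f"
proof -
  obtain K where K: "compact K" "\<And>x. x \<notin> K \<Longrightarrow> f x = 0" and c: "continuous_on UNIV f"
    using assms by (auto simp: Cc_def)
  have "integrable lborel (\<lambda>x. indicator K x *\<^sub>R f x)"
    using K c by (intro borel_integrable_compact) (auto intro: continuous_on_subset)
  also have "(\<lambda>x. indicator K x *\<^sub>R f x) = f"
    using K(2) by (auto simp: indicator_def)
  finally show ?thesis .
qed

lemma integrable_conv_kernel:
  fixes g h :: "real \<Rightarrow> complex"
  assumes "integrable lborel g" "integrable lborel h"
  shows "integrable (lborel \<Otimes>\<^sub>M lborel) (\<lambda>(t, x). g t * h (x - t) :: complex)"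
proof (rule lborel_pair.Fubini_integrable)
  have [measurable]: "g \<in> borel_measurable borel" "h \<in> borel_measurable borel"
    using assms[THEN borel_measurable_integrable] by simp_all
  show "(\<lambda>(t, x). g t * h (x - t)) \<in> borel_measurable (lborel \<Otimes>\<^sub>M lborel)" by measurable
  have h: "integrable lborel (\<lambda>x. h (x - t))" for t
    using lborel_integrable_real_affine[OF assms(2), of 1 "- t"] by simp
  have "(LINT x|lborel. norm (h (x - t))) = (LINT x|lborel. norm (h x))" for t
    using lborel_integral_real_affine[of 1 "\<lambda>x. norm (h x)" "- t"] by simp
  then have "(\<lambda>t. LINT x|lborel. norm (case (t, x) of (t, x) \<Rightarrow> g t * h (x - t)))
      = (\<lambda>t. norm (g t) * (LINT x|lborel. norm (h x)))"
    by (simp add: norm_mult)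
  then show "integrable lborel (\<lambda>t. LINT x|lborel. norm (case (t, x) of (t, x) \<Rightarrow> g t * h (x - t)))"
    using assms by simp
  show "AE t in lborel. integrable lborel (\<lambda>x. case (t, x) of (t, x) \<Rightarrow> g t * h (x - t))"
    using h by simp
qed

lemma integrable_conv:
  assumes "integrable lborel g" "integrable lborel h"
  shows "integrable lborel (conv g h)"
  unfolding conv_def
  using integrable_conv_kernel[OF assms] by (rule lborel_pair.integrable_snd)

text \<open>Phrased with sequences, the form in which dominated convergence applies; the dominating
  function \<open>norm (g t) * M\<close> is independent of the shift.\<close>

lemma conv_sequentially_continuous:
  assumes "g \<in> Cc" "h \<in> Cc" "X \<longlonglongrightarrow> x"
  shows "(\<lambda>n. conv g h (X n)) \<longlonglongrightarrow> conv g h x"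
proof -
  obtain M where M: "\<And>x. norm (h x) \<le> M" using Cc_bounded[OF assms(2)] by blast
  note [measurable] = Cc_measurable[OF assms(1)] Cc_measurable[OF assms(2)]
  show ?thesis
    unfolding conv_def
  proof (rule integral_dominated_convergence[where w = "\<lambda>t. norm (g t) * M"])
    show "integrable lborel (\<lambda>t. norm (g t) * M)" using Cc_integrable[OF assms(1)] by simp
    have "isCont h y" for y using assms(2) by (simp add: Cc_def continuous_on_eq_continuous_at)
    then show "AE t in lborel. (\<lambda>n. g t * h (X n - t)) \<longlonglongrightarrow> g t * h (x - t)"
      using assms(3) by (intro always_eventually allI tendsto_intros isCont_tendsto_compose[of _ h])
    show "AE t in lborel. norm (g t * h (X n - t)) \<le> norm (g t) * M" for n
      using M by (simp add: norm_mult mult_left_mono)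
  qed simp_all
qed

lemma conv_bounded:
  assumes "g \<in> Cc" "h \<in> Cc"
  obtains B where "\<And>x. norm (conv g h x) \<le> B"
proof -
  obtain M where M: "M > 0" "\<And>x. norm (h x) \<le> M" using Cc_bounded[OF assms(2)] by blast
  show thesis
  proof (rule that)
    fix x
    have "norm (g t * h (x - t)) \<le> norm (g t) * M" for t
      using M by (simp add: norm_mult mult_left_mono)
    moreover have "integrable lborel (\<lambda>t. norm (g t) * M)"
      using Cc_integrable[OF assms(1)] by simp
    ultimately show "norm (conv g h x) \<le> (LINT t|lborel. norm (g t) * M)"
      unfolding conv_def by (intro order_trans[OF integral_norm_bound] integral_mono') (use M in auto)
  qed
qed

lemma integrable_mult_cis:
  assumes "integrable lborel f"
  shows "integrable lborel (\<lambda>t. f t * cis (a * t))"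
proof (rule Bochner_Integration.integrable_bound[OF assms])
  have [measurable]: "f \<in> borel_measurable borel" using assms[THEN borel_measurable_integrable] by simp
  have "(\<lambda>t. cis (a * t)) \<in> borel_measurable borel"
    by (intro borel_measurable_continuous_onI continuous_intros)
  then show "(\<lambda>t. f t * cis (a * t)) \<in> borel_measurable lborel" by simp
qed (simp add: norm_mult)

lemma icheck_measurable:
  assumes "integrable lborel f"
  shows "icheck f \<in> borel_measurable borel"
proof -
  have [measurable]: "f \<in> borel_measurable borel" using assms[THEN borel_measurable_integrable] by simp
  have [measurable]: "cis \<in> borel_measurable borel"
    by (intro borel_measurable_continuous_onI continuous_intros)
  show ?thesis unfolding icheck_def by measurable
qed

lemma norm_icheck_le:
  assumes "integrable lborel f"
  shows "norm (icheck f x) \<le> (LINT t|lborel. norm (f t))"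
proof -
  have "norm (icheck f x) \<le> (LINT t|lborel. norm (f t * cis (2 * pi * x * t)))"
    unfolding icheck_def by (rule integral_norm_bound)
  then show ?thesis by (simp add: norm_mult)
qed

text \<open>After Fubini the character splits as e y = e t * e (y - t), and translation invariance
  removes \<open>t\<close> from the inner integral.\<close>

lemma icheck_conv:
  assumes "integrable lborel g" "integrable lborel h"
  shows "icheck (conv g h) x = icheck g x * icheck h x"
proof -
  define e where "e t = cis (2 * pi * x * t)" for t
  have [measurable]: "g \<in> borel_measurable borel" "h \<in> borel_measurable borel"
    using assms[THEN borel_measurable_integrable] by simp_all
  have [measurable]: "e \<in> borel_measurable borel"
    unfolding e_def by (intro borel_measurable_continuous_onI continuous_intros)
  have int: "integrable (lborel \<Otimes>\<^sub>M lborel) (\<lambda>(t, y). g t * h (y - t) * e y)"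
  proof (rule Bochner_Integration.integrable_bound[OF integrable_conv_kernel[OF assms]])
    show "(\<lambda>(t, y). g t * h (y - t) * e y) \<in> borel_measurable (lborel \<Otimes>\<^sub>M lborel)" by measurable
  qed (auto simp: norm_mult e_def)
  have "icheck (conv g h) x = (LINT y|lborel. (LINT t|lborel. g t * h (y - t) * e y))"
    by (simp add: icheck_def conv_def e_def)
  also have "\<dots> = (LINT t|lborel. (LINT y|lborel. g t * h (y - t) * e y))"
    using int by (rule lborel_pair.Fubini_integral)
  also have "\<dots> = (LINT t|lborel. g t * e t * icheck h x)"
  proof (rule Bochner_Integration.integral_cong)
    fix t
    have "(LINT y|lborel. g t * h (y - t) * e y) = (LINT y|lborel. g t * e t * (h (y - t) * e (y - t)))"
      by (intro Bochner_Integration.integral_cong) (simp_all add: e_def algebra_simps flip: cis_mult cis_divide)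
    also have "\<dots> = g t * e t * (LINT y|lborel. h (y - t) * e (y - t))" by simp
    also have "(LINT y|lborel. h (y - t) * e (y - t)) = (LINT y|lborel. h y * e y)"
      using lborel_integral_real_affine[of 1 "\<lambda>y. h y * e y" "- t"] by simp
    finally show "(LINT y|lborel. g t * h (y - t) * e y) = g t * e t * icheck h x"
      by (simp add: icheck_def e_def)
  qed simp
  also have "\<dots> = icheck g x * icheck h x"
    by (simp add: icheck_def e_def)
  finally show ?thesis .
qed

section \<open>Gaussian summation of Fourier integrals\<close>

lemma std_normal_cis_integral:
  "(LINT u|lborel. complex_of_real (std_normal_density u) * cis (a * u)) = of_real (exp (- a\<^sup>2 / 2))"
proof -
  have "char std_normal_distribution a = (LINT u|lborel. std_normal_density u *\<^sub>R iexp (a * u))"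
    unfolding char_def by (subst integral_density) (auto simp: normal_density_nonneg)
  then show ?thesis
    by (simp add: char_std_normal_distribution scaleR_conv_of_real cis_conv_exp)
qed

text \<open>Fubini moves the transform from \<open>F\<close> to the Gaussian, which is again a
  Gaussian. The substitutions x = s u and t = v / (2 pi s) contribute s and 1 / (2 pi s), the two
  normalisations sqrt (2 pi) each, and these constants multiply to 1.\<close>

lemma icheck_gauss_integral:
  fixes s :: real
  assumes "integrable lborel F" "s > 0"
  shows "(LINT x|lborel. icheck F x * of_real (exp (- (x / s)\<^sup>2 / 2)))
       = (LINT v|lborel. F (v / (2 * pi * s)) * of_real (std_normal_density v))"
proof -
  have [measurable]: "F \<in> borel_measurable borel" using assms(1)[THEN borel_measurable_integrable] by simp
  have [measurable]: "cis \<in> borel_measurable borel"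
    by (intro borel_measurable_continuous_onI continuous_intros)
  let ?\<phi> = "\<lambda>u. complex_of_real (std_normal_density u)"
  have \<phi>: "exp (- u\<^sup>2 / 2) = sqrt (2 * pi) * std_normal_density u" for u
    by (simp add: std_normal_density_def)
  have int: "integrable (lborel \<Otimes>\<^sub>M lborel) (\<lambda>(t, u). F t * cis (2 * pi * (s * u) * t) * ?\<phi> u)"
  proof (rule lborel_pair.Fubini_integrable)
    show "(\<lambda>(t, u). F t * cis (2 * pi * (s * u) * t) * ?\<phi> u) \<in> borel_measurable (lborel \<Otimes>\<^sub>M lborel)"
      by measurable
    show "integrable lborel (\<lambda>t. LINT u|lborel. norm (case (t, u) of (t, u) \<Rightarrow> F t * cis (2 * pi * (s * u) * t) * ?\<phi> u))"
      using assms(1) by (simp add: norm_mult)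
    have "integrable lborel ?\<phi>"
      using integrable_normal_density[of 1 0] by (intro integrable_of_real) simp
    then have "integrable lborel (\<lambda>u. F t * (?\<phi> u * cis (2 * pi * s * t * u)))" for t
      by (intro integrable_mult_right integrable_mult_cis)
    then show "AE t in lborel. integrable lborel (\<lambda>u. case (t, u) of (t, u) \<Rightarrow> F t * cis (2 * pi * (s * u) * t) * ?\<phi> u)"
      by (simp add: mult_ac)
  qed
  have "(LINT x|lborel. icheck F x * of_real (exp (- (x / s)\<^sup>2 / 2)))
      = s *\<^sub>R (LINT u|lborel. icheck F (s * u) * of_real (exp (- u\<^sup>2 / 2)))"
    using assms(2) by (subst lborel_integral_real_affine[of s _ 0]) auto
  also have "\<dots> = of_real (s * sqrt (2 * pi)) * (LINT u|lborel. icheck F (s * u) * ?\<phi> u)"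
    unfolding \<phi> by (simp add: scaleR_conv_of_real mult_ac flip: integral_mult_right_zero)
  also have "(LINT u|lborel. icheck F (s * u) * ?\<phi> u)
      = (LINT u|lborel. (LINT t|lborel. F t * cis (2 * pi * (s * u) * t) * ?\<phi> u))"
    by (simp add: icheck_def)
  also have "\<dots> = (LINT t|lborel. (LINT u|lborel. F t * cis (2 * pi * (s * u) * t) * ?\<phi> u))"
    using int by (rule lborel_pair.Fubini_integral)
  also have "\<dots> = (LINT t|lborel. F t * of_real (exp (- (2 * pi * s * t)\<^sup>2 / 2)))"
  proof (rule Bochner_Integration.integral_cong)
    fix t
    have "(LINT u|lborel. F t * cis (2 * pi * (s * u) * t) * ?\<phi> u)
        = (LINT u|lborel. F t * (?\<phi> u * cis ((2 * pi * s * t) * u)))"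
      by (simp add: mult_ac)
    also have "\<dots> = F t * of_real (exp (- (2 * pi * s * t)\<^sup>2 / 2))"
      by (simp only: integral_mult_right_zero std_normal_cis_integral)
    finally show "(LINT u|lborel. F t * cis (2 * pi * (s * u) * t) * ?\<phi> u)
        = F t * of_real (exp (- (2 * pi * s * t)\<^sup>2 / 2))" .
  qed simp
  also have "\<dots> = (1 / (2 * pi * s)) *\<^sub>R (LINT v|lborel. F (v / (2 * pi * s)) * of_real (exp (- v\<^sup>2 / 2)))"
    using assms(2) by (subst lborel_integral_real_affine[of "1 / (2 * pi * s)" _ 0]) auto
  also have "\<dots> = of_real (1 / (2 * pi * s) * sqrt (2 * pi)) * (LINT v|lborel. F (v / (2 * pi * s)) * ?\<phi> v)"
    unfolding \<phi> by (simp add: scaleR_conv_of_real mult_ac flip: integral_mult_right_zero)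
  also have "of_real (s * sqrt (2 * pi)) * (of_real (1 / (2 * pi * s) * sqrt (2 * pi)) * (LINT v|lborel. F (v / (2 * pi * s)) * ?\<phi> v))
      = of_real (s * sqrt (2 * pi) * (1 / (2 * pi * s) * sqrt (2 * pi))) * (LINT v|lborel. F (v / (2 * pi * s)) * ?\<phi> v)"
    by (simp only: of_real_mult mult.assoc)
  also have "s * sqrt (2 * pi) * (1 / (2 * pi * s) * sqrt (2 * pi)) = (sqrt (2 * pi) * sqrt (2 * pi)) / (2 * pi)"
    using assms(2) by (simp add: field_simps)
  also have "\<dots> = 1" by (simp only: real_sqrt_mult_self) simp
  finally show ?thesis by simp
qed

text \<open>The dilation sits in the argument of \<open>F\<close> and not in the density, so a
  single multiple of the normal density dominates for all \<open>n\<close>.\<close>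

lemma std_normal_dilate_tendsto:
  fixes F :: "real \<Rightarrow> complex"
  assumes "F \<in> borel_measurable borel" "\<And>x. norm (F x) \<le> B" "\<And>X. X \<longlonglongrightarrow> 0 \<Longrightarrow> (\<lambda>n. F (X n)) \<longlonglongrightarrow> F 0"
  shows "(\<lambda>n. LINT v|lborel. F (v / (2 * pi * real (Suc n))) * of_real (std_normal_density v)) \<longlonglongrightarrow> F 0"
proof -
  note [measurable] = assms(1)
  have "(\<lambda>n. LINT v|lborel. F (v / (2 * pi * real (Suc n))) * of_real (std_normal_density v))
      \<longlonglongrightarrow> (LINT v|lborel. F 0 * of_real (std_normal_density v))"
  proof (rule integral_dominated_convergence[where w = "\<lambda>v. B * std_normal_density v"])
    show "integrable lborel (\<lambda>v. B * std_normal_density v)"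
      using integrable_normal_density[of 1 0] by simp
    have "(\<lambda>n. v / (2 * pi * real (Suc n))) \<longlonglongrightarrow> 0" for v by real_asymp
    then show "AE v in lborel. (\<lambda>n. F (v / (2 * pi * real (Suc n))) * of_real (std_normal_density v))
        \<longlonglongrightarrow> F 0 * of_real (std_normal_density v)"
      by (intro always_eventually allI tendsto_mult_right assms(3))
    show "AE v in lborel. norm (F (v / (2 * pi * real (Suc n))) * of_real (std_normal_density v))
        \<le> B * std_normal_density v" for n
      using assms(2) by (simp add: norm_mult mult_right_mono)
  qed simp_all
  moreover have "(LINT v|lborel. F 0 * complex_of_real (std_normal_density v)) = F 0"
    using integral_normal_density[of 1 0] by simp
  ultimately show ?thesis by simp
qed

text \<open>Fourier inversion at 0 in summability form. It rests on \<open>conv g h\<close> being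
  integrable, bounded and continuous at 0, and assumes no integrability of the transforms.\<close>

lemma icheck_conv_gauss_tendsto:
  assumes "g \<in> Cc" "h \<in> Cc"
  shows "(\<lambda>n. LINT x|lborel. icheck g x * icheck h x * of_real (exp (- (x / real (Suc n))\<^sup>2 / 2)))
           \<longlonglongrightarrow> conv g h 0"
proof -
  note int = Cc_integrable[OF assms(1)] Cc_integrable[OF assms(2)]
  have F: "integrable lborel (conv g h)" by (rule integrable_conv[OF int])
  obtain B where B: "\<And>x. norm (conv g h x) \<le> B" using conv_bounded[OF assms] by blast
  have "(\<lambda>n. LINT x|lborel. icheck (conv g h) x * of_real (exp (- (x / real (Suc n))\<^sup>2 / 2))) \<longlonglongrightarrow> conv g h 0"
  proof (subst icheck_gauss_integral[OF F])
    show "(\<lambda>n. LINT v|lborel. conv g h (v / (2 * pi * real (Suc n))) * of_real (std_normal_density v)) \<longlonglongrightarrow> conv g h 0"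
      using borel_measurable_integrable[OF F] B conv_sequentially_continuous[OF assms]
      by (intro std_normal_dilate_tendsto) simp_all
  qed simp
  then show ?thesis by (simp only: icheck_conv[OF int])
qed

lemma gauss_weight_mono:
  "incseq (\<lambda>n. exp (- (x / real (Suc n))\<^sup>2 / 2))"
  by (intro incseq_SucI) (auto simp: power_divide field_simps intro!: mult_left_mono)

lemma gauss_weight_tendsto:
  "(\<lambda>n. exp (- (x / real (Suc n))\<^sup>2 / 2)) \<longlonglongrightarrow> 1"
proof -
  have "(\<lambda>n. x / real (Suc n)) \<longlonglongrightarrow> 0" by real_asymp
  moreover have "isCont (\<lambda>y::real. exp (- y\<^sup>2 / 2)) 0" by (intro continuous_intros) simp
  ultimately have "(\<lambda>n. exp (- (x / real (Suc n))\<^sup>2 / 2)) \<longlonglongrightarrow> exp (- 0\<^sup>2 / 2)"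
    by (rule isCont_tendsto_compose[rotated])
  then show ?thesis by simp
qed

lemma gauss_weight_integrable:
  fixes s :: real
  assumes "s > 0"
  shows "integrable lborel (\<lambda>x. exp (- (x / s)\<^sup>2 / 2))"
proof -
  have "integrable lborel (\<lambda>x. sqrt (2 * pi) * std_normal_density (0 + (1 / s) * x))"
    using integrable_normal_density[of 1 0] assms
    by (intro integrable_mult_right lborel_integrable_real_affine) auto
  then show ?thesis by (simp add: std_normal_density_def)
qed

text \<open>Makes the product of the transforms of \<open>f\<close> and of its reflected conjugate a
  squared modulus, hence nonnegative, as monotone convergence demands.\<close>

lemma icheck_cnj_reflect:
  "icheck (\<lambda>t. cnj (f (- t))) x = cnj (icheck f x)"
proof -
  have "icheck (\<lambda>t. cnj (f (- t))) x = (LINT t|lborel. cnj (f t) * cis (2 * pi * x * (- t)))"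
    unfolding icheck_def by (subst lborel_integral_real_affine[of "-1" _ 0]) auto
  also have "\<dots> = (LINT t|lborel. cnj (f t * cis (2 * pi * x * t)))"
    by (simp add: cis_cnj)
  also have "\<dots> = cnj (icheck f x)" unfolding icheck_def by (rule Bochner_Integration.integral_cnj)
  finally show ?thesis .
qed

lemma Cc_cnj_reflect:
  assumes "f \<in> Cc"
  shows "(\<lambda>t. cnj (f (- t))) \<in> Cc"
proof -
  obtain K where K: "compact K" "\<And>x. x \<notin> K \<Longrightarrow> f x = 0" and c: "continuous_on UNIV f"
    using assms by (auto simp: Cc_def)
  have "continuous_on UNIV (\<lambda>t. cnj (f (- t)))"
    by (intro continuous_intros continuous_on_compose2[OF c]) auto
  moreover have "compact (uminus ` K)" using K(1) by (rule compact_negations)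
  moreover have "\<forall>x. x \<notin> uminus ` K \<longrightarrow> cnj (f (- x)) = 0"
    using K(2) by (metis complex_cnj_zero imageI minus_minus)
  ultimately show ?thesis unfolding Cc_def by blast
qed

lemma integrable_icheck_square:
  assumes "g \<in> Cc"
  shows "integrable lborel (\<lambda>x. (norm (icheck g x))\<^sup>2)"
proof -
  let ?g' = "\<lambda>t. cnj (g (- t))"
  let ?w = "\<lambda>n x. exp (- (x / real (Suc n))\<^sup>2 / 2)"
  note int = Cc_integrable[OF assms]
  note [measurable] = icheck_measurable[OF int]
  have eq: "icheck g x * icheck ?g' x * of_real (?w n x) = of_real ((norm (icheck g x))\<^sup>2 * ?w n x)" for n x
    by (simp add: icheck_cnj_reflect complex_norm_square del: of_real_power)
  have lim: "(\<lambda>n. LINT x|lborel. complex_of_real ((norm (icheck g x))\<^sup>2 * ?w n x)) \<longlonglongrightarrow> conv g ?g' 0"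
    using icheck_conv_gauss_tendsto[OF assms Cc_cnj_reflect[OF assms]] unfolding eq .
  \<comment> \<open>The integrands are real, so real parts carry the limit over to real integrals;
    its finiteness is what makes the monotone limit integrable.\<close>
  have lim': "(\<lambda>n. LINT x|lborel. (norm (icheck g x))\<^sup>2 * ?w n x) \<longlonglongrightarrow> Re (conv g ?g' 0)"
    using tendsto_Re[OF lim] by (simp only: integral_complex_of_real Re_complex_of_real)
  show ?thesis
  proof (rule integrable_monotone_convergence[where f = "\<lambda>n x. (norm (icheck g x))\<^sup>2 * ?w n x"])
    fix n
    show "integrable lborel (\<lambda>x. (norm (icheck g x))\<^sup>2 * ?w n x)"
    proof (rule Bochner_Integration.integrable_bound)
      \<comment> \<open>For fixed \<open>n\<close> the transform is bounded by the L1 norm of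
        \<open>g\<close>, so the Gaussian weight supplies the integrability.\<close>
      show "integrable lborel (\<lambda>x. (LINT t|lborel. norm (g t))\<^sup>2 * ?w n x)"
        by (intro integrable_mult_right gauss_weight_integrable) simp
      show "AE x in lborel. norm ((norm (icheck g x))\<^sup>2 * ?w n x) \<le> norm ((LINT t|lborel. norm (g t))\<^sup>2 * ?w n x)"
        using norm_icheck_le[OF int] by (simp add: abs_mult mult_right_mono power_mono)
    qed measurable
  next
    show "AE x in lborel. incseq (\<lambda>n. (norm (icheck g x))\<^sup>2 * ?w n x)"
      using gauss_weight_mono by (auto simp: incseq_def intro!: mult_left_mono)
    show "AE x in lborel. (\<lambda>n. (norm (icheck g x))\<^sup>2 * ?w n x) \<longlonglongrightarrow> (norm (icheck g x))\<^sup>2"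
      using tendsto_mult[OF tendsto_const gauss_weight_tendsto] by force
  qed (use lim' in simp_all)
qed

lemma integrable_icheck_mult:
  assumes "g \<in> Cc" "h \<in> Cc"
  shows "integrable lborel (\<lambda>x. icheck g x * icheck h x)"
proof (rule Bochner_Integration.integrable_bound)
  note [measurable] = assms[THEN Cc_integrable, THEN icheck_measurable]
  show "integrable lborel (\<lambda>x. (norm (icheck g x))\<^sup>2 + (norm (icheck h x))\<^sup>2)"
    using assms by (intro Bochner_Integration.integrable_add integrable_icheck_square)
  show "(\<lambda>x. icheck g x * icheck h x) \<in> borel_measurable lborel" by measurable
  have "a * b \<le> a\<^sup>2 + b\<^sup>2" if "a \<ge> 0" "b \<ge> 0" for a b :: real
    using sum_squares_bound[of a b] mult_nonneg_nonneg[OF that] by linarith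
  then show "AE x in lborel. norm (icheck g x * icheck h x) \<le> norm ((norm (icheck g x))\<^sup>2 + (norm (icheck h x))\<^sup>2)"
    by (simp add: norm_mult)
qed

lemma dirac0_eq_return: "dirac0 = return borel 0"
  by (simp add: dirac0_def return_def)

lemma integral_dirac0:
  fixes f :: "real \<Rightarrow> complex"
  assumes "f \<in> borel_measurable borel"
  shows "integral\<^sup>L dirac0 f = f 0"
  unfolding dirac0_eq_return using assms by (intro integral_return) auto

lemma fourier_transform_dirac0: "fourier_transform_of dirac0 lborel"
  unfolding fourier_transform_of_def
proof (intro conjI ballI)
  fix g h assume gh: "g \<in> Cc" "h \<in> Cc"
  let ?w = "\<lambda>n x. exp (- (x / real (Suc n))\<^sup>2 / 2)"
  note int = gh[THEN Cc_integrable]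
  note [measurable] = int[THEN icheck_measurable]
  have eq: "icheck (conv g h) = (\<lambda>x. icheck g x * icheck h x)"
    using icheck_conv[OF int] by auto
  show I: "integrable lborel (icheck (conv g h))"
    unfolding eq by (rule integrable_icheck_mult[OF gh])
  have "(\<lambda>n. LINT x|lborel. icheck g x * icheck h x * of_real (?w n x)) \<longlonglongrightarrow> (LINT x|lborel. icheck g x * icheck h x)"
  proof (rule integral_dominated_convergence[where w = "\<lambda>x. norm (icheck g x * icheck h x)"])
    show "integrable lborel (\<lambda>x. norm (icheck g x * icheck h x))"
      by (intro integrable_norm integrable_icheck_mult gh)
    have "(\<lambda>n. complex_of_real (?w n x)) \<longlonglongrightarrow> of_real 1" for x
      by (intro tendsto_of_real gauss_weight_tendsto)
    from tendsto_mult[OF tendsto_const this]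
    show "AE x in lborel. (\<lambda>n. icheck g x * icheck h x * of_real (?w n x)) \<longlonglongrightarrow> icheck g x * icheck h x"
      by force
    show "AE x in lborel. norm (icheck g x * icheck h x * of_real (?w n x)) \<le> norm (icheck g x * icheck h x)" for n
      by (simp add: norm_mult mult_left_le)
  qed simp_all
  \<comment> \<open>The same weighted integrals tend to \<open>conv g h 0\<close>, which is the
    integral against \<open>dirac0\<close>.\<close>
  from LIMSEQ_unique[OF icheck_conv_gauss_tendsto[OF gh] this]
  show "integral\<^sup>L dirac0 (conv g h) = integral\<^sup>L lborel (icheck (conv g h))"
    using integrable_conv[OF int] by (simp add: eq integral_dirac0 borel_measurable_integrable)
qed simp

subsection \<open>The counting autocorrelation of the primes\<close>

lemma signed_primes_Int_interval:
  "signed_primes \<inter> {- real n..real n}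
     = real ` {p. prime p \<and> p \<le> n} \<union> (\<lambda>p. - real p) ` {p. prime p \<and> p \<le> n}"
  by (auto simp: signed_primes_def)

lemma card_signed_primes_Int_interval:
  "card (signed_primes \<inter> {- real n..real n}) = 2 * card {p. prime p \<and> p \<le> n}"
proof -
  have "real p \<noteq> - real q" if "prime p" for p q
    using prime_gt_0_nat[OF that] by linarith
  then have "real ` {p. prime p \<and> p \<le> n} \<inter> (\<lambda>p. - real p) ` {p. prime p \<and> p \<le> n} = {}"
    by blast
  then show ?thesis
    unfolding signed_primes_Int_interval
    by (subst card_Un_disjoint) (simp_all add: card_image inj_on_def)
qed

text \<open>Points of equal sign give a pair p, p + k up to sign and order, whence the 4. Points of
  opposite sign at distance at most \<open>R\<close> both have modulus at most \<open>R\<close>,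
  which leaves at most 2 (R + 1)^2 pairs whatever \<open>n\<close> is.\<close>

lemma card_close_signed_primes_le:
  fixes n R :: nat
  defines "F \<equiv> signed_primes \<inter> {- real n..real n}"
  shows "card {(x, y). x \<in> F \<and> y \<in> F \<and> x \<noteq> y \<and> \<bar>x - y\<bar> \<le> R}
     \<le> 4 * (\<Sum>k\<in>{1..R}. card {p\<in>{1..n}. prime p \<and> prime (p + k)}) + 2 * (R + 1)\<^sup>2"
proof -
  \<comment> \<open>Only the smaller prime is confined to 1..n. This overcounts, harmlessly for an
    upper bound, and matches the sieve estimate.\<close>
  define A where "A k = {p\<in>{1..n}. prime p \<and> prime (p + k)}" for k
  define S :: "(real \<times> real) set" where "S = {1, -1} \<times> {1, -1}"
  define f :: "nat \<Rightarrow> real \<Rightarrow> nat \<Rightarrow> real \<times> real" where "f k s p = (s * p, s * (p + k))" for k s p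
  define U where "U = (\<Union>k\<in>{1..R}. \<Union>s\<in>{1, -1}. f k s ` A k \<union> prod.swap ` f k s ` A k)"
  define V :: "(real \<times> real) set" where "V = (\<Union>s\<in>{1, -1}. (\<lambda>(i, j). (s * real i, - s * real j)) ` ({..R} \<times> {..R}))"
  have key: "(s * real p, s * real q) \<in> U"
    if "prime p" "p \<le> n" "prime q" "q \<le> n" "p \<noteq> q" "\<bar>real p - real q\<bar> \<le> R" "s \<in> {1, -1}" for p q s
  proof (cases p q rule: linorder_cases)
    case less
    then have "p \<in> A (q - p)" "q - p \<in> {1..R}" "(s * real p, s * real q) = f (q - p) s p"
      using that prime_gt_0_nat[of p] by (auto simp: A_def f_def Suc_le_eq of_nat_diff)
    then show ?thesis unfolding U_def using that(7) by blast
  next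
    case greater
    then have "q \<in> A (p - q)" "p - q \<in> {1..R}" "(s * real p, s * real q) = prod.swap (f (p - q) s q)"
      using that prime_gt_0_nat[of q] by (auto simp: A_def f_def Suc_le_eq of_nat_diff)
    then show ?thesis unfolding U_def using that(7) by blast
  qed (use that in auto)
  have far: "(s * real p, - s * real q) \<in> V" if "\<bar>s * real p + s * real q\<bar> \<le> R" "s \<in> {1, -1}" for p q s
    using that unfolding V_def by (intro UN_I[of s] image_eqI[of _ _ "(p, q)"]) auto
  have F: "\<exists>s p. s \<in> {1, -1} \<and> x = s * real p \<and> prime p \<and> p \<le> n" if "x \<in> F" for x
  proof -
    from that consider p where "prime p" "p \<le> n" "x = 1 * real p"
      | p where "prime p" "p \<le> n" "x = -1 * real p"
      unfolding F_def signed_primes_Int_interval by auto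
    then show ?thesis by cases blast+
  qed
  have sub: "{(x, y). x \<in> F \<and> y \<in> F \<and> x \<noteq> y \<and> \<bar>x - y\<bar> \<le> R} \<subseteq> U \<union> V"
  proof clarify
    fix x y assume xy: "x \<in> F" "y \<in> F" "x \<noteq> y" "\<bar>x - y\<bar> \<le> real R" "(x, y) \<notin> V"
    obtain s p where p: "s \<in> {1, -1}" "x = s * real p" "prime p" "p \<le> n" using F[OF xy(1)] by blast
    obtain t q where q: "t \<in> {1, -1}" "y = t * real q" "prime q" "q \<le> n" using F[OF xy(2)] by blast
    show "(x, y) \<in> U"
    proof (cases "t = s")
      case True
      then show ?thesis unfolding p(2) q(2) True using p q xy True by (intro key) auto
    next
      case False
      then have y: "y = - s * real q" using p q by auto
      have "(s * real p, - s * real q) \<in> V" using xy(4) p y by (intro far) simp_all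
      with xy(5) p(2) y show ?thesis by simp
    qed
  qed
  have finA: "finite (A k)" for k by (simp add: A_def)
  have "card U \<le> (\<Sum>k\<in>{1..R}. card (\<Union>s\<in>{1, -1}. f k s ` A k \<union> prod.swap ` f k s ` A k))"
    unfolding U_def by (rule card_UN_le) simp
  also have "\<dots> \<le> (\<Sum>k\<in>{1..R}. 4 * card (A k))"
  proof (rule sum_mono)
    fix k
    have "card (\<Union>s\<in>{1, -1}. f k s ` A k \<union> prod.swap ` f k s ` A k)
        \<le> (\<Sum>s\<in>{1, -1}. card (f k s ` A k \<union> prod.swap ` f k s ` A k))"
      by (rule card_UN_le) simp
    also have "\<dots> \<le> (\<Sum>s\<in>{1, -1 :: real}. card (A k) + card (A k))"
      using finA by (intro sum_mono order_trans[OF card_Un_le] add_mono)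
        (auto simp: image_image intro: card_image_le)
    finally show "card (\<Union>s\<in>{1, -1}. f k s ` A k \<union> prod.swap ` f k s ` A k) \<le> 4 * card (A k)"
      by simp
  qed
  finally have U: "card U \<le> 4 * (\<Sum>k\<in>{1..R}. card (A k))" by (simp add: sum_distrib_left)
  have "card V \<le> (\<Sum>s\<in>{1, -1 :: real}. card ((\<lambda>(i, j). (s * real i, - s * real j)) ` ({..R} \<times> {..R})))"
    unfolding V_def by (rule card_UN_le) simp
  also have "\<dots> \<le> (\<Sum>s\<in>{1, -1 :: real}. card ({..R} \<times> {..R}))"
    by (intro sum_mono card_image_le) simp
  finally have V: "card V \<le> 2 * (R + 1)\<^sup>2" by (simp add: power2_eq_square)
  have "finite (U \<union> V)" by (auto simp: U_def V_def A_def)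
  then have "card {(x, y). x \<in> F \<and> y \<in> F \<and> x \<noteq> y \<and> \<bar>x - y\<bar> \<le> R} \<le> card U + card V"
    using card_mono[OF _ sub] card_Un_le order_trans by blast
  with U V show ?thesis by (simp add: A_def)
qed

lemma norm_gammaF_diff_le:
  fixes f :: "real \<Rightarrow> complex"
  assumes "finite F" "F \<noteq> {}" "\<And>x. norm (f x) \<le> M" "\<And>x. r < \<bar>x\<bar> \<Longrightarrow> f x = 0"
  shows "norm (gammaF F f - f 0) \<le> M * card {(x, y). x \<in> F \<and> y \<in> F \<and> x \<noteq> y \<and> \<bar>x - y\<bar> \<le> r} / card F"
proof -
  define Q where "Q = {(x, y). x \<in> F \<and> y \<in> F \<and> x \<noteq> y \<and> \<bar>x - y\<bar> \<le> r}"
  define D where "D = (\<lambda>x. (x, x)) ` F"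
  have Q: "Q \<subseteq> F \<times> F" "Q \<inter> D = {}" "D \<subseteq> F \<times> F" by (auto simp: Q_def D_def)
  have fin: "finite Q" "finite D" using Q assms(1) by (auto intro: finite_subset[of _ "F \<times> F"])
  have "(\<Sum>x\<in>F. \<Sum>y\<in>F. f (x - y)) = (\<Sum>(x, y)\<in>F \<times> F. f (x - y))"
    by (simp add: sum.cartesian_product)
  also have "\<dots> = (\<Sum>(x, y)\<in>D \<union> Q. f (x - y))"
    using assms Q by (intro sum.mono_neutral_right) (auto simp: Q_def D_def not_le)
  also have "\<dots> = (\<Sum>(x, y)\<in>D. f (x - y)) + (\<Sum>(x, y)\<in>Q. f (x - y))"
    using fin Q by (intro sum.union_disjoint) auto
  also have "(\<Sum>(x, y)\<in>D. f (x - y)) = of_nat (card F) * f 0"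
    unfolding D_def by (subst sum.reindex) (auto simp: inj_on_def)
  finally have "gammaF F f - f 0 = (\<Sum>(x, y)\<in>Q. f (x - y)) / of_nat (card F)"
    using assms by (simp add: gammaF_def field_simps)
  moreover have "norm (\<Sum>(x, y)\<in>Q. f (x - y)) \<le> M * card Q"
    using sum_norm_bound[of Q "\<lambda>(x, y). f (x - y)" M] assms(3) by (auto simp: mult.commute)
  ultimately show ?thesis
    by (simp add: norm_divide divide_right_mono Q_def)
qed

lemma signed_primes_counting_autocorrelation:
  "has_counting_autocorrelation signed_primes (\<lambda>n. {- real n..real n}) dirac0"
  unfolding has_counting_autocorrelation_def
proof
  fix f assume f: "f \<in> Cc"
  define F where "F n = signed_primes \<inter> {- real n..real n}" for n
  define T where "T k n = real (card {p\<in>{1..n}. prime p \<and> prime (p + k)})" for k n :: nat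
  obtain M where M: "M > 0" "\<And>x. norm (f x) \<le> M" using Cc_bounded[OF f] by blast
  obtain K where K: "compact K" "\<And>x. x \<notin> K \<Longrightarrow> f x = 0" using f by (auto simp: Cc_def)
  obtain b where b: "\<And>x. x \<in> K \<Longrightarrow> \<bar>x\<bar> \<le> b"
    using compact_imp_bounded[OF K(1)] by (auto simp: bounded_iff)
  \<comment> \<open>Rounding the radius up to a natural number lets the differences of primes be
    indexed by k in 1..R.\<close>
  define R where "R = nat \<lceil>b\<rceil>"
  have "b \<le> real R" unfolding R_def by linarith
  then have R: "f x = 0" if "real R < \<bar>x\<bar>" for x using K(2) b that by force
  have "\<forall>\<^sub>F n in sequentially. norm (gammaF (F n) f - f 0)
      \<le> M / ln 2 * (4 * (\<Sum>k\<in>{1..R}. T k n * ln n / n) + 2 * (1 + real R)\<^sup>2 * (ln n / n))"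
    using eventually_ge_at_top[of 2]
  proof eventually_elim
    case (elim n)
    let ?P = "{p. prime p \<and> p \<le> n}"
    define c where "c = 4 * (\<Sum>k\<in>{1..R}. T k n) + 2 * (1 + real R)\<^sup>2"
    have c: "c \<ge> 0" by (simp add: c_def T_def sum_nonneg)
    \<comment> \<open>From n = 2 on \<open>F n\<close> is nonempty, so the default value of
      \<open>gammaF\<close> at the empty set does not intervene.\<close>
    have "2 \<in> ?P" using elim by simp
    then have "?P \<noteq> {}" by blast
    then have P: "card ?P > 0" by (simp add: card_gt_0_iff)
    have F: "card (F n) = 2 * card ?P" by (simp add: F_def card_signed_primes_Int_interval)
    with P have "card (F n) > 0" by linarith
    then have "finite (F n)" "F n \<noteq> {}" unfolding card_gt_0_iff by blast+
    then have "norm (gammaF (F n) f - f 0)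
        \<le> M * card {(x, y). x \<in> F n \<and> y \<in> F n \<and> x \<noteq> y \<and> \<bar>x - y\<bar> \<le> R} / card (F n)"
      using M(2) R by (rule norm_gammaF_diff_le)
    also have "\<dots> \<le> M * c / card (F n)"
    proof (intro divide_right_mono mult_left_mono)
      show "real (card {(x, y). x \<in> F n \<and> y \<in> F n \<and> x \<noteq> y \<and> \<bar>x - y\<bar> \<le> R}) \<le> c"
        using of_nat_mono[OF card_close_signed_primes_le[of n R], where ?'a = real]
        by (simp add: F_def c_def T_def)
    qed (use M in auto)
    also have "\<dots> \<le> M * c / (n * ln 2 / ln n)"
    proof (intro divide_left_mono mult_nonneg_nonneg c)
      \<comment> \<open>The two signs double the number of primes; since n <= 2 (n - 1) for n >= 2,
        this factor absorbs the passage from n - 1 to n.\<close>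
      have "real n * ln 2 \<le> 2 * (real (n - 1) * ln 2)" using elim by (simp add: of_nat_diff)
      also have "\<dots> \<le> real (card (F n)) * ln n"
        using prime_counting_lower_bound[of n] elim by (simp add: F)
      finally show "n * ln 2 / ln n \<le> card (F n)" using elim by (simp add: field_simps)
    qed (use M elim F P in auto)
    also have "\<dots> = M / ln 2 * (4 * (\<Sum>k\<in>{1..R}. T k n * ln n / n) + 2 * (1 + real R)\<^sup>2 * (ln n / n))"
    proof -
      have "4 * (\<Sum>k\<in>{1..R}. T k n * ln n / n) + 2 * (1 + real R)\<^sup>2 * (ln n / n) = c * ln n / n"
        by (simp add: c_def distrib_right add_divide_distrib flip: sum_divide_distrib sum_distrib_right)
      then show ?thesis by (simp add: mult_ac)
    qed
    finally show ?case .
  qed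
  moreover have "(\<lambda>n. M / ln 2 * (4 * (\<Sum>k\<in>{1..R}. T k n * ln n / n) + 2 * (1 + real R)\<^sup>2 * (ln n / n))) \<longlonglongrightarrow> 0"
  proof (rule tendsto_eq_rhs)
    show "(\<lambda>n. M / ln 2 * (4 * (\<Sum>k\<in>{1..R}. T k n * ln n / n) + 2 * (1 + real R)\<^sup>2 * (ln n / n)))
      \<longlonglongrightarrow> M / ln 2 * (4 * (\<Sum>k\<in>{1..R}. (0::real)) + 2 * (1 + real R)\<^sup>2 * 0)"
    proof (intro tendsto_mult[OF tendsto_const] tendsto_add tendsto_sum)
      show "(\<lambda>n. T k n * ln n / n) \<longlonglongrightarrow> 0" if "k \<in> {1..R}" for k
        unfolding T_def using that by (intro card_prime_pairs_tendsto) auto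
      show "(\<lambda>n. ln (real n) / n) \<longlonglongrightarrow> 0" by real_asymp
    qed
  qed simp
  ultimately have "(\<lambda>n. gammaF (F n) f - f 0) \<longlonglongrightarrow> 0"
    by (rule Lim_null_comparison)
  then have "(\<lambda>n. gammaF (F n) f) \<longlonglongrightarrow> f 0" by (rule LIM_zero_cancel)
  then show "(\<lambda>n. gammaF (signed_primes \<inter> {- real n..real n}) f) \<longlonglongrightarrow> integral\<^sup>L dirac0 f"
    unfolding F_def using f by (simp add: integral_dirac0 Cc_measurable)
qed

theorem theorem5p7:
  shows "has_counting_autocorrelation signed_primes (\<lambda>n. {- real n .. real n}) dirac0
       \<and> fourier_transform_of dirac0 lborel"
  using signed_primes_counting_autocorrelation fourier_transform_dirac0 by blast

end
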